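(* Let $K:(0,T]\to\mathbb R$ be a square-integrable deterministic kernel that is infinitely differentiable on $(0,T]$, with $n$-th derivative $K^{(n)}$, and satisfies, for every $t\in(0,T]$, $$\sum_{n=0}^\infty|K^{(n)}(t)|\frac{t^{n+\frac12}}{n!\sqrt{2n+1}}<\infty,\qquad \int_0^t\Big(\sum_{n=0}^\infty|K^{(n)}(t)|\frac{s^n}{n!}\Big)^2ds<\infty,$$ as well as $$\int_0^T\Big(\sum_{n=0}^\infty|K^{(n)}(t)|\frac{t^{n+\frac12}}{n!\sqrt{2n+1}}\Big)dt<\infty.$$ Let $X$ be the continuous Gaussian Volterra process $X_t=\int_0^tK(t-s)\,dW_s$, and define $\ell_t\in T((\mathbb R^2))$ by $$\ell_t=\begin{cases}\displaystyle\sum_{n=0}^\infty K^{(n)}(t)(-1)^n\,\mathbf 1^{\otimes n}\mathbf 2&\text{if }t\in(0,T],\\[2mm]0&\text{if }t=0.\end{cases}$$ Then for every $t\in[0,T]$, $X_t=\langle\ell_t,\widehat{\mathbb W}_t\rangle$ almost surely.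
   Context: Fix $T>0$, a complete filtered probability space satisfying the usual conditions and a one-dimensional Brownian motion $W$ on it. Words are finite sequences of the letters $\mathbf 1,\mathbf 2$; $V_n$ is the set of words of length $n$, with $V_0=\{\emptyset\}$. $T((\mathbb R^2))$ is the space of formal series $\ell=\sum_{n\ge0}\sum_{v\in V_n}\ell^vv$ with $\ell^v\in\mathbb R$; $\mathbf 1^{\otimes n}\mathbf 2$ is the word consisting of $n$ letters $\mathbf 1$ followed by the letter $\mathbf 2$. The signature of $\widehat W_t=(t,W_t)$ (coordinate $\mathbf 1$ is time, coordinate $\mathbf 2$ is $W$) is given by $\widehat{\mathbb W}^{\emptyset}_t=1$ and $\widehat{\mathbb W}^{v\mathbf i}_t=\int_0^t\widehat{\mathbb W}^v_s\circ d\widehat W^{\mathbf i}_s$ (Stratonovich). The bracket is $\langle\ell,\widehat{\mathbb W}_t\rangle=\sum_{n\ge0}\sum_{v\in V_n}\ell^v\widehat{\mathbb W}^v_t$, which is well-defined whenever $\sum_{n\ge0}\big|\sum_{v\in V_n}\ell^v\widehat{\mathbb W}^v_t\big|<\infty$ almost surely. *)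

theory Defs
  imports "HOL-Probability.Probability"
begin

section \<open>Filtered probability spaces and Brownian motion\<close>

text \<open>Time is a real parameter, and all processes and filtrations are only constrained
  on \<open>{0..T}\<close>.\<close>

locale usual_filtered_prob_space = prob_space M + complete_measure M
  for M :: "'a measure" +
  fixes F :: "real \<Rightarrow> 'a measure" and T :: real
  assumes subalgebra_F: "\<And>t. t \<in> {0..T} \<Longrightarrow> subalgebra M (F t)"
    and F_mono: "\<And>s t. 0 \<le> s \<Longrightarrow> s \<le> t \<Longrightarrow> t \<le> T \<Longrightarrow> sets (F s) \<subseteq> sets (F t)"
    and null_sets_F: "null_sets M \<subseteq> sets (F 0)"
    and right_continuous_F: "\<And>t. 0 \<le> t \<Longrightarrow> t < T \<Longrightarrow> sets (F t) = (\<Inter>s\<in>{t<..T}. sets (F s))"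

definition adapted_process ::
  "(real \<Rightarrow> 'a measure) \<Rightarrow> real \<Rightarrow> (real \<Rightarrow> 'a \<Rightarrow> real) \<Rightarrow> bool" where
  "adapted_process F T Y \<longleftrightarrow> (\<forall>t\<in>{0..T}. Y t \<in> borel_measurable (F t))"

definition continuous_process ::
  "'a measure \<Rightarrow> real \<Rightarrow> (real \<Rightarrow> 'a \<Rightarrow> real) \<Rightarrow> bool" where
  "continuous_process M T Y \<longleftrightarrow> (AE \<omega> in M. continuous_on {0..T} (\<lambda>t. Y t \<omega>))"

definition progressively_measurable ::
  "(real \<Rightarrow> 'a measure) \<Rightarrow> real \<Rightarrow> (real \<Rightarrow> 'a \<Rightarrow> real) \<Rightarrow> bool" where
  "progressively_measurable F T Y \<longleftrightarrow>
     (\<forall>t\<in>{0..T}. (\<lambda>(s, \<omega>). Y s \<omega>) \<in> borel_measurable (restrict_space borel {0..t} \<Otimes>\<^sub>M F t))"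

definition brownian_motion ::
  "'a measure \<Rightarrow> (real \<Rightarrow> 'a measure) \<Rightarrow> real \<Rightarrow> (real \<Rightarrow> 'a \<Rightarrow> real) \<Rightarrow> bool" where
  "brownian_motion M F T W \<longleftrightarrow>
     adapted_process F T W \<and> continuous_process M T W \<and> (AE \<omega> in M. W 0 \<omega> = 0) \<and>
     (\<forall>s t. 0 \<le> s \<and> s < t \<and> t \<le> T \<longrightarrow>
        distributed M lborel (\<lambda>\<omega>. W t \<omega> - W s \<omega>) (normal_density 0 (sqrt (t - s))) \<and>
        prob_space.indep_set M (sets (F s))
          (sets (vimage_algebra (space M) (\<lambda>\<omega>. W t \<omega> - W s \<omega>) borel)))"


section \<open>It\^o and Stratonovich integrals\<close>

text \<open>The data \<open>(n, \<tau>, \<xi>)\<close> stands for the simple process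
  \<open>\<Sum>i<n. \<xi>\<^sub>i 1\<^bsub>(\<tau>\<^sub>i, \<tau>\<^sub>i\<^sub>+\<^sub>1]\<^esub>\<close> on \<open>[0, t]\<close>,
  where \<open>\<xi>\<^sub>i\<close> is bounded and measurable at time \<open>\<tau>\<^sub>i\<close>.\<close>

definition simple_integrand ::
  "'a measure \<Rightarrow> (real \<Rightarrow> 'a measure) \<Rightarrow> real \<Rightarrow> nat \<Rightarrow> (nat \<Rightarrow> real) \<Rightarrow> (nat \<Rightarrow> 'a \<Rightarrow> real) \<Rightarrow> bool" where
  "simple_integrand M F t n \<tau> \<xi> \<longleftrightarrow>
     0 \<le> \<tau> 0 \<and> \<tau> n \<le> t \<and> (\<forall>i<n. \<tau> i \<le> \<tau> (Suc i)) \<and>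
     (\<forall>i<n. \<xi> i \<in> borel_measurable (F (\<tau> i))) \<and>
     (\<exists>B. \<forall>i<n. \<forall>\<omega>\<in>space M. \<bar>\<xi> i \<omega>\<bar> \<le> B)"

definition simple_process ::
  "nat \<Rightarrow> (nat \<Rightarrow> real) \<Rightarrow> (nat \<Rightarrow> 'a \<Rightarrow> real) \<Rightarrow> real \<Rightarrow> 'a \<Rightarrow> real" where
  "simple_process n \<tau> \<xi> s \<omega> = (\<Sum>i<n. \<xi> i \<omega> * indicator {\<tau> i<..\<tau> (Suc i)} s)"

definition simple_ito ::
  "(real \<Rightarrow> 'a \<Rightarrow> real) \<Rightarrow> nat \<Rightarrow> (nat \<Rightarrow> real) \<Rightarrow> (nat \<Rightarrow> 'a \<Rightarrow> real) \<Rightarrow> 'a \<Rightarrow> real" where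
  "simple_ito W n \<tau> \<xi> \<omega> = (\<Sum>i<n. \<xi> i \<omega> * (W (\<tau> (Suc i)) \<omega> - W (\<tau> i) \<omega>))"

text \<open>\<open>has_ito_integral M F W t H J\<close> says that \<open>J\<close> is a version of the It\^o integral
  \<open>\<integral>\<^sub>0\<^sup>t H\<^sub>s dW\<^sub>s\<close>, as the mean-square extension of the elementary integral. As with
  \<^const>\<open>has_integral\<close>, this is a relation; it determines \<open>J\<close> up to null sets.
  Measurability of the integrand must be demanded explicitly, because
  \<^const>\<open>nn_integral\<close> of a non-measurable function is only a lower integral.\<close>

definition has_ito_integral ::
  "'a measure \<Rightarrow> (real \<Rightarrow> 'a measure) \<Rightarrow> (real \<Rightarrow> 'a \<Rightarrow> real) \<Rightarrow> real \<Rightarrow>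
   (real \<Rightarrow> 'a \<Rightarrow> real) \<Rightarrow> ('a \<Rightarrow> real) \<Rightarrow> bool" where
  "has_ito_integral M F W t H J \<longleftrightarrow>
     progressively_measurable F t H \<and> J \<in> borel_measurable M \<and>
     (\<exists>n \<tau> \<xi>.
        (\<forall>k. simple_integrand M F t (n k) (\<tau> k) (\<xi> k)) \<and>
        ((\<lambda>k. \<integral>\<^sup>+\<omega>. (\<integral>\<^sup>+s\<in>{0..t}.
            ennreal ((H s \<omega> - simple_process (n k) (\<tau> k) (\<xi> k) s \<omega>)\<^sup>2) \<partial>lborel) \<partial>M) \<longlonglongrightarrow> 0) \<and>
        ((\<lambda>k. \<integral>\<^sup>+\<omega>. ennreal ((J \<omega> - simple_ito W (n k) (\<tau> k) (\<xi> k) \<omega>)\<^sup>2) \<partial>M) \<longlonglongrightarrow> 0))"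

definition partition_mesh_less :: "real \<Rightarrow> real \<Rightarrow> nat \<Rightarrow> (nat \<Rightarrow> real) \<Rightarrow> bool" where
  "partition_mesh_less t \<delta> n \<tau> \<longleftrightarrow>
     \<tau> 0 = 0 \<and> \<tau> n = t \<and> (\<forall>i<n. \<tau> i \<le> \<tau> (Suc i) \<and> \<tau> (Suc i) - \<tau> i < \<delta>)"

text \<open>\<open>has_covariation M Y Z t C\<close>: \<open>C\<close> is a version of the bracket \<open>[Y, Z]\<^sub>t\<close>, the limit in
  probability of the sums of products of increments as the mesh of the partition of \<open>[0, t]\<close>
  tends to \<open>0\<close>.\<close>

definition has_covariation ::
  "'a measure \<Rightarrow> (real \<Rightarrow> 'a \<Rightarrow> real) \<Rightarrow> (real \<Rightarrow> 'a \<Rightarrow> real) \<Rightarrow> real \<Rightarrow> ('a \<Rightarrow> real) \<Rightarrow> bool" where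
  "has_covariation M Y Z t C \<longleftrightarrow>
     C \<in> borel_measurable M \<and>
     (\<forall>\<epsilon>>0. \<exists>\<delta>>0. \<forall>n \<tau>. partition_mesh_less t \<delta> n \<tau> \<longrightarrow>
        measure M {\<omega> \<in> space M.
          \<bar>(\<Sum>i<n. (Y (\<tau> (Suc i)) \<omega> - Y (\<tau> i) \<omega>) * (Z (\<tau> (Suc i)) \<omega> - Z (\<tau> i) \<omega>)) - C \<omega>\<bar> > \<epsilon>} < \<epsilon>)"

datatype letter = Letter1 | Letter2

type_synonym word = "letter list"

text \<open>The time-augmented path \<open>(t, W\<^sub>t)\<close>.\<close>

fun augmented :: "(real \<Rightarrow> 'a \<Rightarrow> real) \<Rightarrow> letter \<Rightarrow> real \<Rightarrow> 'a \<Rightarrow> real" where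
  "augmented W Letter1 t \<omega> = t"
| "augmented W Letter2 t \<omega> = W t \<omega>"

fun has_augmented_integral ::
  "'a measure \<Rightarrow> (real \<Rightarrow> 'a measure) \<Rightarrow> (real \<Rightarrow> 'a \<Rightarrow> real) \<Rightarrow> letter \<Rightarrow> real \<Rightarrow>
   (real \<Rightarrow> 'a \<Rightarrow> real) \<Rightarrow> ('a \<Rightarrow> real) \<Rightarrow> bool" where
  "has_augmented_integral M F W Letter1 t Y J \<longleftrightarrow>
     (AE \<omega> in M. set_integrable lborel {0..t} (\<lambda>s. Y s \<omega>) \<and> J \<omega> = (LINT s:{0..t}|lborel. Y s \<omega>))"
| "has_augmented_integral M F W Letter2 t Y J \<longleftrightarrow> has_ito_integral M F W t Y J"

text \<open>\<open>\<integral> Y \<circ> dZ = \<integral> Y dZ + [Y, Z] / 2\<close>, where \<open>Z\<close> is a component of the augmented path.\<close>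

definition has_stratonovich_integral ::
  "'a measure \<Rightarrow> (real \<Rightarrow> 'a measure) \<Rightarrow> (real \<Rightarrow> 'a \<Rightarrow> real) \<Rightarrow> letter \<Rightarrow> real \<Rightarrow>
   (real \<Rightarrow> 'a \<Rightarrow> real) \<Rightarrow> ('a \<Rightarrow> real) \<Rightarrow> bool" where
  "has_stratonovich_integral M F W i t Y I \<longleftrightarrow>
     (\<exists>J C. has_augmented_integral M F W i t Y J \<and>
        has_covariation M Y (augmented W i) t C \<and>
        (AE \<omega> in M. I \<omega> = J \<omega> + C \<omega> / 2))"


section \<open>Signature, formal series and bracket\<close>

text \<open>The iterated integrals are determined up to indistinguishability, so the signature is
  characterised as a family of continuous adapted processes. The last letter of a word is the
  outermost integration.\<close>

definition is_signature ::
  "'a measure \<Rightarrow> (real \<Rightarrow> 'a measure) \<Rightarrow> real \<Rightarrow> (real \<Rightarrow> 'a \<Rightarrow> real) \<Rightarrow>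
   (word \<Rightarrow> real \<Rightarrow> 'a \<Rightarrow> real) \<Rightarrow> bool" where
  "is_signature M F T W S \<longleftrightarrow>
     (\<forall>v. adapted_process F T (S v) \<and> continuous_process M T (S v)) \<and>
     (\<forall>t\<in>{0..T}. AE \<omega> in M. S [] t \<omega> = 1) \<and>
     (\<forall>v i. \<forall>t\<in>{0..T}. has_stratonovich_integral M F W i t (S v) (S (v @ [i]) t))"

definition words :: "nat \<Rightarrow> word set" where
  "words n = {v. length v = n}"

text \<open>Elements of \<open>T((\<real>\<^sup>2))\<close>, given by their coefficients.\<close>

type_synonym formal_series = "word \<Rightarrow> real"

definition word_series :: "word \<Rightarrow> formal_series" where
  "word_series w v = of_bool (v = w)"

definition bracket_term :: "formal_series \<Rightarrow> formal_series \<Rightarrow> nat \<Rightarrow> real" where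
  "bracket_term l S n = (\<Sum>v\<in>words n. l v * S v)"

definition bracket :: "formal_series \<Rightarrow> formal_series \<Rightarrow> real" where
  "bracket l S = (\<Sum>n. bracket_term l S n)"

definition bracket_defined :: "formal_series \<Rightarrow> formal_series \<Rightarrow> bool" where
  "bracket_defined l S \<longleftrightarrow> summable (\<lambda>n. \<bar>bracket_term l S n\<bar>)"


section \<open>Volterra processes\<close>

text \<open>\<open>D n\<close> is the \<open>n\<close>-th derivative of \<open>f\<close> on \<open>A\<close>, one-sided at endpoints contained in \<open>A\<close>.\<close>

definition has_derivatives_on ::
  "(real \<Rightarrow> real) \<Rightarrow> (nat \<Rightarrow> real \<Rightarrow> real) \<Rightarrow> real set \<Rightarrow> bool" where
  "has_derivatives_on f D A \<longleftrightarrow>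
     (\<forall>t\<in>A. D 0 t = f t) \<and>
     (\<forall>n. \<forall>t\<in>A. (D n has_real_derivative D (Suc n) t) (at t within A))"

text \<open>Gaussianity needs no separate clause, the integrand being deterministic. The value
  \<open>K 0\<close> is irrelevant: it only enters at the single time \<open>s = t\<close>.\<close>

definition volterra_process ::
  "'a measure \<Rightarrow> (real \<Rightarrow> 'a measure) \<Rightarrow> real \<Rightarrow> (real \<Rightarrow> 'a \<Rightarrow> real) \<Rightarrow> (real \<Rightarrow> real) \<Rightarrow>
   (real \<Rightarrow> 'a \<Rightarrow> real) \<Rightarrow> bool" where
  "volterra_process M F T W K X \<longleftrightarrow>
     continuous_process M T X \<and>
     (\<forall>t\<in>{0..T}. has_ito_integral M F W t (\<lambda>s \<omega>. K (t - s)) (X t))"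

text \<open>The formal sum is taken coefficientwise; every coefficient has at most one nonzero
  summand.\<close>

definition volterra_series :: "(nat \<Rightarrow> real \<Rightarrow> real) \<Rightarrow> real \<Rightarrow> formal_series" where
  "volterra_series D t =
     (if t = 0 then (\<lambda>v. 0)
      else (\<lambda>v. \<Sum>n. D n t * (-1) ^ n * word_series (replicate n Letter1 @ [Letter2]) v))"

end

theory Submission
  imports Defs
begin

text \<open>
  Only the words \<open>1\<^sup>n2\<close> carry a coefficient, so the bracket is the series
  \<open>\<Sum>n. (-1)\<^sup>n K\<^bsup>(n)\<^esup>(t) S(1\<^sup>n2)\<^sub>t\<close>. The theorem is the Taylor expansion of \<open>s \<mapsto> K (t - s)\<close> around
  \<open>s = 0\<close>, integrated term by term against Brownian motion.

  \<^item> The component of the signature along \<open>1\<^sup>n\<close> is \<open>t\<^sup>n / n!\<close>. Being monotone, it has zero covariation with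
    every continuous path, so the Stratonovich correction vanishes at each step, and \<open>S(1\<^sup>n2)\<^sub>t\<close> is
    the Ito integral of the deterministic function \<open>s\<^sup>n / n!\<close>
    (\<open>signature_time_words\<close>, \<open>signature_wiener_integral\<close>).

  \<^item> \<open>X\<^sub>t\<close> is the Ito integral of \<open>K (t - s)\<close>. Linearity and the Ito isometry therefore bound the mean
    square of \<open>X\<^sub>t - (\<Sum>n<N. (-1)\<^sup>n K\<^bsup>(n)\<^esup>(t) S(1\<^sup>n2)\<^sub>t)\<close> by a multiple of the squared \<open>L\<^sup>2(0, t)\<close> norm of
    the Taylor remainder of \<open>K (t - s)\<close>. A constant factor does no harm here, and
    \<open>wiener_integral_mean_square_le\<close> is content with the factor 4; this way the exact isometry is
    only needed for step processes.

  \<^item> A smooth function need not equal its Taylor series, even where that series converges. What forces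
    equality is the third condition on \<open>K\<close>: it bounds
    \<open>\<integral> \<bar>K\<^bsup>(N)\<^esup>(u)\<bar> u\<^bsup>N+1/2\<^esup> / (N! sqrt (2N+1)) du\<close> uniformly in \<open>N\<close>, and in the integral form of the
    remainder the factor \<open>(s - x) / (t - x)\<close> is at most \<open>s / t < 1\<close>. Hence the remainder decays
    geometrically for each \<open>s < t\<close> (\<open>taylor_series_sums_kernel\<close>). The second condition supplies the
    dominating function that turns pointwise into \<open>L\<^sup>2(0, t)\<close> convergence
    (\<open>taylor_square_error_tendsto_0\<close>).

  \<^item> The first condition bounds the sum of the first absolute moments of the terms, because the
    mean square of \<open>S(1\<^sup>n2)\<^sub>t\<close> is at most 4 times \<open>(t\<^bsup>n+1/2\<^esup> / (n! sqrt (2n+1)))\<^sup>2\<close>. So the series converges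
    absolutely almost surely, and Fatou's lemma identifies its sum with the mean-square limit
    \<open>X\<^sub>t\<close> (\<open>series_eq_mean_square_limit\<close>).
\<close>

section \<open>Increments of Brownian motion\<close>

locale brownian_space = usual_filtered_prob_space M F T
  for M :: "'a measure" and F :: "real \<Rightarrow> 'a measure" and T :: real +
  fixes W :: "real \<Rightarrow> 'a \<Rightarrow> real"
  assumes brownian: "brownian_motion M F T W"
begin

lemma space_F: "t \<in> {0..T} \<Longrightarrow> space (F t) = space M"
  using subalgebra_F by (auto simp: subalgebra_def)

lemma measurable_F_mono:
  assumes "U \<in> borel_measurable (F s)" "0 \<le> s" "s \<le> t" "t \<le> T"
  shows "U \<in> borel_measurable (F t)"
proof -
  have "subalgebra (F t) (F s)"
    using F_mono assms space_F[of s] space_F[of t] by (auto simp: subalgebra_def)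
  then show ?thesis
    using assms(1) by (rule measurable_from_subalg)
qed

lemma measurable_F_M:
  assumes "U \<in> borel_measurable (F s)" "0 \<le> s" "s \<le> T"
  shows "U \<in> borel_measurable M"
  using measurable_from_subalg[OF subalgebra_F[of s] assms(1)] assms(2,3) by simp

lemma W_measurable_F: "0 \<le> s \<Longrightarrow> s \<le> T \<Longrightarrow> W s \<in> borel_measurable (F s)"
  using brownian by (auto simp: brownian_motion_def adapted_process_def)

lemma W_measurable [measurable]: "0 \<le> s \<Longrightarrow> s \<le> T \<Longrightarrow> W s \<in> borel_measurable M"
  using W_measurable_F measurable_F_M by blast

lemma increment_indep:
  assumes U: "U \<in> borel_measurable (F s)" and st: "0 \<le> s" "s < t" "t \<le> T"
  shows "indep_var borel U borel (\<lambda>\<omega>. W t \<omega> - W s \<omega>)"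
proof -
  let ?V = "\<lambda>\<omega>. W t \<omega> - W s \<omega>"
  have ind: "indep_set (sets (F s)) (sets (vimage_algebra (space M) ?V borel))"
    using brownian st by (auto simp: brownian_motion_def)
  have sp: "space (F s) = space M"
    using space_F st by simp
  have "{U -` A \<inter> space M |A. A \<in> sets borel} \<subseteq> sets (F s)"
    using measurable_sets[OF U] unfolding sp by blast
  then have "sigma_sets (space M) {U -` A \<inter> space M |A. A \<in> sets borel} \<subseteq> sets (F s)"
    using sets.sigma_sets_subset[of _ "F s"] unfolding sp by blast
  moreover have "sigma_sets (space M) {?V -` A \<inter> space M |A. A \<in> sets borel}
      = sets (vimage_algebra (space M) ?V borel)"
    by (simp add: sets_vimage_algebra)
  ultimately have "indep_set (sigma_sets (space M) {U -` A \<inter> space M |A. A \<in> sets borel})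
      (sigma_sets (space M) {?V -` A \<inter> space M |A. A \<in> sets borel})"
    using ind unfolding indep_sets2_eq by blast
  then show ?thesis
    unfolding indep_var_eq using measurable_F_M[OF U] st by simp
qed

lemma increment_moments:
  assumes "0 \<le> s" "s < t" "t \<le> T"
  shows "integrable M (\<lambda>\<omega>. W t \<omega> - W s \<omega>)" "expectation (\<lambda>\<omega>. W t \<omega> - W s \<omega>) = 0"
    and "integrable M (\<lambda>\<omega>. (W t \<omega> - W s \<omega>)\<^sup>2)"
    and "expectation (\<lambda>\<omega>. (W t \<omega> - W s \<omega>)\<^sup>2) = t - s"
proof -
  let ?V = "\<lambda>\<omega>. W t \<omega> - W s \<omega>"
  have sig: "0 < sqrt (t - s)" using assms by simp
  have D: "distributed M lborel ?V (normal_density 0 (sqrt (t - s)))"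
    using brownian assms by (auto simp: brownian_motion_def)
  show "integrable M ?V"
    using distributed_integrable[OF D, of "\<lambda>x. x"] integrable_normal_moment[OF sig, of 0 1] by simp
  show *: "expectation ?V = 0"
    by (rule normal_distributed_expectation[OF sig D])
  show "integrable M (\<lambda>\<omega>. (?V \<omega>)\<^sup>2)"
    using distributed_integrable[OF D, of "\<lambda>x. x\<^sup>2"] integrable_normal_moment[OF sig, of 0 2] by simp
  show "expectation (\<lambda>\<omega>. (?V \<omega>)\<^sup>2) = t - s"
    using normal_distributed_variance[OF sig D] assms unfolding * by simp
qed

text \<open>Independence of the increment from the past factorises both expectations. They are the only
  moments that the isometry for step processes rests on.\<close>

lemma past_times_increment:
  assumes U: "U \<in> borel_measurable (F s)" "integrable M U" and st: "0 \<le> s" "s \<le> t" "t \<le> T"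
  shows "has_bochner_integral M (\<lambda>\<omega>. U \<omega> * (W t \<omega> - W s \<omega>)) 0"
    and "has_bochner_integral M (\<lambda>\<omega>. U \<omega> * (W t \<omega> - W s \<omega>)\<^sup>2) (expectation U * (t - s))"
proof -
  have "has_bochner_integral M (\<lambda>\<omega>. U \<omega> * (W t \<omega> - W s \<omega>)) 0 \<and>
    has_bochner_integral M (\<lambda>\<omega>. U \<omega> * (W t \<omega> - W s \<omega>)\<^sup>2) (expectation U * (t - s))"
  proof (cases "s = t")
    case True
    then show ?thesis by (simp add: has_bochner_integral_zero)
  next
    case False
    with st have lt: "s < t" by simp
    note i1 = increment_indep[OF U(1) st(1) lt st(3)]
    have i2: "indep_var borel U borel (\<lambda>\<omega>. (W t \<omega> - W s \<omega>)\<^sup>2)"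
      using indep_var_compose[OF i1, of "\<lambda>x. x" borel "\<lambda>x. x\<^sup>2" borel] by (simp add: comp_def)
    note m = increment_moments[OF st(1) lt st(3)]
    show ?thesis
      using indep_var_integrable[OF i1 U(2) m(1)] indep_var_lebesgue_integral[OF i1 U(2) m(1)]
        indep_var_integrable[OF i2 U(2) m(3)] indep_var_lebesgue_integral[OF i2 U(2) m(3)] m(2,4)
      by (simp add: has_bochner_integral_iff)
  qed
  then show "has_bochner_integral M (\<lambda>\<omega>. U \<omega> * (W t \<omega> - W s \<omega>)) 0"
    and "has_bochner_integral M (\<lambda>\<omega>. U \<omega> * (W t \<omega> - W s \<omega>)\<^sup>2) (expectation U * (t - s))"
    by auto
qed

definition bounded_at :: "real \<Rightarrow> ('a \<Rightarrow> real) \<Rightarrow> bool" where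
  "bounded_at s U \<longleftrightarrow> U \<in> borel_measurable (F s) \<and> (\<exists>B. \<forall>\<omega>\<in>space M. \<bar>U \<omega>\<bar> \<le> B)"

lemma bounded_at_integrable:
  assumes "bounded_at s U" "0 \<le> s" "s \<le> T"
  shows "integrable M U"
proof -
  obtain B where "\<forall>\<omega>\<in>space M. \<bar>U \<omega>\<bar> \<le> B" using assms by (auto simp: bounded_at_def)
  moreover have "U \<in> borel_measurable M"
    using assms measurable_F_M by (auto simp: bounded_at_def)
  ultimately show ?thesis
    by (intro integrable_const_bound[where B = B]) (auto intro!: AE_I2)
qed

lemma bounded_at_mono: "bounded_at s U \<Longrightarrow> 0 \<le> s \<Longrightarrow> s \<le> t \<Longrightarrow> t \<le> T \<Longrightarrow> bounded_at t U"
  using measurable_F_mono by (auto simp: bounded_at_def)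

lemma bounded_at_mult: "bounded_at s U \<Longrightarrow> bounded_at s V \<Longrightarrow> bounded_at s (\<lambda>\<omega>. U \<omega> * V \<omega>)"
proof -
  assume a: "bounded_at s U" "bounded_at s V"
  obtain B C where B: "\<forall>\<omega>\<in>space M. \<bar>U \<omega>\<bar> \<le> B" and C: "\<forall>\<omega>\<in>space M. \<bar>V \<omega>\<bar> \<le> C"
    using a by (auto simp: bounded_at_def)
  have "\<forall>\<omega>\<in>space M. \<bar>U \<omega> * V \<omega>\<bar> \<le> B * C"
    using B C by (fastforce simp: abs_mult intro!: mult_mono)
  then show ?thesis using a by (auto simp: bounded_at_def)
qed

text \<open>The longer increment is split at \<open>b\<close>; the part after \<open>b\<close> is orthogonal to everything known
  at time \<open>b\<close>.\<close>

lemma increment_product_same_start: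
  assumes U: "bounded_at c U" and le: "0 \<le> c" "c \<le> b" "b \<le> d" "d \<le> T"
  shows "has_bochner_integral M (\<lambda>\<omega>. U \<omega> * ((W b \<omega> - W c \<omega>) * (W d \<omega> - W c \<omega>)))
    (expectation U * (b - c))"
proof -
  have Um: "U \<in> borel_measurable (F c)" and Ui: "integrable M U"
    using U bounded_at_integrable[OF U] le by (simp_all add: bounded_at_def)
  have 1: "has_bochner_integral M (\<lambda>\<omega>. U \<omega> * (W b \<omega> - W c \<omega>)) 0"
    and 2: "has_bochner_integral M (\<lambda>\<omega>. U \<omega> * (W b \<omega> - W c \<omega>)\<^sup>2) (expectation U * (b - c))"
    using past_times_increment[OF Um Ui, of b] le by auto
  have "(\<lambda>\<omega>. U \<omega> * (W b \<omega> - W c \<omega>)) \<in> borel_measurable (F b)"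
    using measurable_F_mono[OF Um, of b] measurable_F_mono[OF W_measurable_F, of c b]
      W_measurable_F[of b] le by auto
  then have 3: "has_bochner_integral M (\<lambda>\<omega>. U \<omega> * (W b \<omega> - W c \<omega>) * (W d \<omega> - W b \<omega>)) 0"
    using past_times_increment(1)[of _ b d] 1 le by (auto simp: has_bochner_integral_iff)
  show ?thesis
    using has_bochner_integral_add[OF 2 3] by (simp add: algebra_simps power2_eq_square)
qed

text \<open>Splitting \<open>(a, b]\<close> at \<open>c\<close> leaves a piece that lies in the past of \<open>c\<close>, which contributes nothing,
  and a piece with the same starting point as \<open>(c, d]\<close>.\<close>

lemma increment_product_ordered:
  assumes \<xi>: "bounded_at a \<xi>" and \<eta>: "bounded_at c \<eta>"
    and le: "0 \<le> a" "a \<le> b" "b \<le> T" "a \<le> c" "c \<le> d" "d \<le> T"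
  shows "has_bochner_integral M
    (\<lambda>\<omega>. (\<xi> \<omega> * (W b \<omega> - W a \<omega>)) * (\<eta> \<omega> * (W d \<omega> - W c \<omega>)))
    (expectation (\<lambda>\<omega>. \<xi> \<omega> * \<eta> \<omega>) * max 0 (min b d - c))"
proof -
  let ?U = "\<lambda>\<omega>. \<xi> \<omega> * \<eta> \<omega>"
  have c0: "0 \<le> c" and aT: "a \<le> T" and cT: "c \<le> T" using le by auto
  have U: "bounded_at c ?U"
    using bounded_at_mult bounded_at_mono[OF \<xi>] \<eta> le by auto
  \<comment> \<open>An increment over \<open>(a, m]\<close> with \<open>m \<le> c\<close>, multiplied by \<open>\<eta>\<close>, is known at time \<open>c\<close>.\<close>
  have past: "has_bochner_integral M (\<lambda>\<omega>. (\<xi> \<omega> * (W m \<omega> - W a \<omega>)) * (\<eta> \<omega> * (W d \<omega> - W c \<omega>))) 0"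
    if m: "a \<le> m" "m \<le> c" for m
  proof -
    obtain B where B: "\<forall>\<omega>\<in>space M. \<bar>\<eta> \<omega>\<bar> \<le> B" using \<eta> by (auto simp: bounded_at_def)
    have ac: "\<xi> \<in> borel_measurable (F a)" using \<xi> by (simp add: bounded_at_def)
    have hm: "\<xi> \<in> borel_measurable (F c)" "W m \<in> borel_measurable (F c)"
      "W a \<in> borel_measurable (F c)" "\<eta> \<in> borel_measurable (F c)"
      using measurable_F_mono[OF ac] measurable_F_mono[OF W_measurable_F, of _ c] m le \<eta>
      by (auto simp: bounded_at_def)
    then have V: "(\<lambda>\<omega>. \<xi> \<omega> * (W m \<omega> - W a \<omega>) * \<eta> \<omega>) \<in> borel_measurable (F c)" by simp
    have i: "integrable M (\<lambda>\<omega>. \<xi> \<omega> * (W m \<omega> - W a \<omega>))"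
      using past_times_increment(1)[OF ac bounded_at_integrable[OF \<xi>], of m] m le
      by (auto simp: has_bochner_integral_iff)
    have "integrable M (\<lambda>\<omega>. \<xi> \<omega> * (W m \<omega> - W a \<omega>) * \<eta> \<omega>)"
    proof (rule Bochner_Integration.integrable_bound[OF integrable_mult_right[OF i, of B]])
      show "(\<lambda>\<omega>. \<xi> \<omega> * (W m \<omega> - W a \<omega>) * \<eta> \<omega>) \<in> borel_measurable M"
        by (rule measurable_F_M[OF V c0 cT])
      show "AE \<omega> in M. norm (\<xi> \<omega> * (W m \<omega> - W a \<omega>) * \<eta> \<omega>)
          \<le> norm (B * (\<xi> \<omega> * (W m \<omega> - W a \<omega>)))"
      proof (rule AE_I2)
        fix \<omega> assume "\<omega> \<in> space M"
        then have "\<bar>\<eta> \<omega>\<bar> \<le> \<bar>B\<bar>" using B by force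
        then have "\<bar>\<xi> \<omega> * (W m \<omega> - W a \<omega>)\<bar> * \<bar>\<eta> \<omega>\<bar> \<le> \<bar>\<xi> \<omega> * (W m \<omega> - W a \<omega>)\<bar> * \<bar>B\<bar>"
          by (intro mult_left_mono) auto
        then show "norm (\<xi> \<omega> * (W m \<omega> - W a \<omega>) * \<eta> \<omega>) \<le> norm (B * (\<xi> \<omega> * (W m \<omega> - W a \<omega>)))"
          by (simp add: abs_mult mult.commute mult.left_commute)
      qed
    qed
    from past_times_increment(1)[OF V this c0 le(5,6)] show ?thesis
      by (simp add: mult.assoc)
  qed
  show ?thesis
  proof (cases "b \<le> c")
    case True
    then have "max 0 (min b d - c) = 0" by simp
    then show ?thesis using past[of b] le True by simp
  next
    case False
    have "has_bochner_integral M (\<lambda>\<omega>. ?U \<omega> * ((W b \<omega> - W c \<omega>) * (W d \<omega> - W c \<omega>)))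
      (expectation ?U * (min b d - c))"
    proof (cases "b \<le> d")
      case True
      then show ?thesis using increment_product_same_start[OF U c0, of b d] False le by simp
    next
      case F: False
      then show ?thesis using increment_product_same_start[OF U c0, of d b] False le
        by (simp add: mult.commute)
    qed
    from has_bochner_integral_add[OF past[OF le(4) order_refl] this]
    have "has_bochner_integral M
      (\<lambda>\<omega>. (\<xi> \<omega> * (W b \<omega> - W a \<omega>)) * (\<eta> \<omega> * (W d \<omega> - W c \<omega>)))
      (0 + expectation ?U * (min b d - c))"
      by (rule back_subst[where P = "\<lambda>f. has_bochner_integral M f _"])
         (simp add: fun_eq_iff algebra_simps)
    moreover have "max 0 (min b d - c) = min b d - c" using False le by simp
    ultimately show ?thesis by simp
  qed
qed

text \<open>The polarised isometry for two one-step integrands on arbitrary, possibly overlapping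
  intervals: the last factor is the length of \<open>(a, b] \<inter> (c, d]\<close>. Allowing overlaps makes common
  refinements of partitions superfluous later on.\<close>

lemma increment_product:
  assumes \<xi>: "bounded_at a \<xi>" and \<eta>: "bounded_at c \<eta>"
    and le: "0 \<le> a" "a \<le> b" "b \<le> T" "0 \<le> c" "c \<le> d" "d \<le> T"
  shows "has_bochner_integral M
    (\<lambda>\<omega>. (\<xi> \<omega> * (W b \<omega> - W a \<omega>)) * (\<eta> \<omega> * (W d \<omega> - W c \<omega>)))
    (expectation (\<lambda>\<omega>. \<xi> \<omega> * \<eta> \<omega>) * max 0 (min b d - max a c))"
proof (cases "a \<le> c")
  case True
  then show ?thesis using increment_product_ordered[OF \<xi> \<eta>, of b d] le by (simp add: max_def)
next
  case False
  then show ?thesis using increment_product_ordered[OF \<eta> \<xi>, of d b] le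
    by (simp add: mult.commute min.commute max.commute max.absorb1)
qed

end

section \<open>Ito isometry for step processes\<close>

lemma interval_overlap_integral:
  fixes a b c d :: real
  shows "has_bochner_integral lborel (\<lambda>s. indicator {a<..b} s * indicator {c<..d} s :: real)
    (max 0 (min b d - max a c))"
proof -
  have eq: "(\<lambda>s. indicator {a<..b} s * indicator {c<..d} s :: real) = indicator {max a c<..min b d}"
    by (auto simp: fun_eq_iff indicator_def)
  have "emeasure lborel {max a c<..min b d} < \<infinity>"
    by (cases "max a c \<le> min b d") auto
  then have "has_bochner_integral lborel (indicator {max a c<..min b d} :: real \<Rightarrow> real)
      (measure lborel {max a c<..min b d})"
    by (intro has_bochner_integral_real_indicator) auto
  moreover have "measure lborel {max a c<..min b d} = max 0 (min b d - max a c)"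
    by (cases "max a c \<le> min b d") (auto simp: max_def)
  ultimately show ?thesis
    unfolding eq by simp
qed

context brownian_space begin

text \<open>Pairs of a step process and its elementary stochastic integral. The pieces may overlap and come
  in any order, so that these pairs form a vector space (\<open>step_pair_add\<close>, \<open>step_pair_scale\<close>), which
  is not evident for simple processes given by partitions.\<close>

inductive step_pair :: "real \<Rightarrow> (real \<Rightarrow> 'a \<Rightarrow> real) \<Rightarrow> ('a \<Rightarrow> real) \<Rightarrow> bool" for t where
  step_pair_zero: "step_pair t (\<lambda>s \<omega>. 0) (\<lambda>\<omega>. 0)"
| step_pair_piece: "step_pair t G A \<Longrightarrow> bounded_at a \<xi> \<Longrightarrow> 0 \<le> a \<Longrightarrow> a \<le> b \<Longrightarrow> b \<le> t \<Longrightarrow>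
    step_pair t (\<lambda>s \<omega>. G s \<omega> + \<xi> \<omega> * indicator {a<..b} s)
      (\<lambda>\<omega>. A \<omega> + \<xi> \<omega> * (W b \<omega> - W a \<omega>))"

lemma step_pair_add:
  assumes "step_pair t G A" "step_pair t G' A'"
  shows "step_pair t (\<lambda>s \<omega>. G s \<omega> + G' s \<omega>) (\<lambda>\<omega>. A \<omega> + A' \<omega>)"
  using assms(2)
proof induction
  case step_pair_zero
  then show ?case using assms(1) by simp
next
  case (step_pair_piece G' A' a \<xi> b)
  from step_pair.step_pair_piece[OF step_pair_piece.IH step_pair_piece.hyps(2-)]
  show ?case by (simp add: add.assoc)
qed

lemma step_pair_scale:
  assumes "step_pair t G A"
  shows "step_pair t (\<lambda>s \<omega>. c * G s \<omega>) (\<lambda>\<omega>. c * A \<omega>)"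
  using assms
proof induction
  case step_pair_zero
  then show ?case using step_pair.step_pair_zero by simp
next
  case (step_pair_piece G A a \<xi> b)
  obtain B where "\<forall>\<omega>\<in>space M. \<bar>\<xi> \<omega>\<bar> \<le> B"
    using step_pair_piece.hyps by (auto simp: bounded_at_def)
  then have "\<forall>\<omega>\<in>space M. \<bar>c * \<xi> \<omega>\<bar> \<le> \<bar>c\<bar> * B"
    by (auto simp: abs_mult intro!: mult_left_mono)
  then have "bounded_at a (\<lambda>\<omega>. c * \<xi> \<omega>)"
    using step_pair_piece.hyps by (auto simp: bounded_at_def)
  from step_pair.step_pair_piece[OF step_pair_piece.IH this step_pair_piece.hyps(3-)]
  show ?case by (simp add: algebra_simps)
qed

lemma step_pair_simple:
  assumes "simple_integrand M F t n \<tau> \<xi>" "t \<le> T"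
  shows "step_pair t (simple_process n \<tau> \<xi>) (simple_ito W n \<tau> \<xi>)"
proof -
  have \<tau>: "0 \<le> \<tau> 0" "\<tau> n \<le> t" "\<And>i. i < n \<Longrightarrow> \<tau> i \<le> \<tau> (Suc i)"
    and \<xi>: "\<And>i. i < n \<Longrightarrow> bounded_at (\<tau> i) (\<xi> i)"
    using assms by (auto simp: simple_integrand_def bounded_at_def) blast+
  have mono: "\<tau> i \<le> \<tau> j" if "i \<le> j" "j \<le> n" for i j
    using that by (induction rule: dec_induct) (auto intro: order_trans[OF _ \<tau>(3)])
  have "step_pair t (simple_process m \<tau> \<xi>) (simple_ito W m \<tau> \<xi>)" if "m \<le> n" for m
    using that
  proof (induction m)
    case 0
    then show ?case
      using step_pair_zero by (simp add: simple_process_def[abs_def] simple_ito_def[abs_def])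
  next
    case (Suc m)
    have "step_pair t (\<lambda>s \<omega>. simple_process m \<tau> \<xi> s \<omega> + \<xi> m \<omega> * indicator {\<tau> m<..\<tau> (Suc m)} s)
      (\<lambda>\<omega>. simple_ito W m \<tau> \<xi> \<omega> + \<xi> m \<omega> * (W (\<tau> (Suc m)) \<omega> - W (\<tau> m) \<omega>))"
      using Suc \<xi>[of m] \<tau>(1,2) \<tau>(3)[of m] mono[of 0 m] mono[of "Suc m" n]
      by (intro step_pair_piece) auto
    then show ?case
      by (simp only: simple_process_def[abs_def] simple_ito_def[abs_def] sum.lessThan_Suc)
  qed
  then show ?thesis by simp
qed

lemma step_pair_support: "step_pair t G A \<Longrightarrow> s \<notin> {0..t} \<Longrightarrow> G s \<omega> = 0"
  by (induction rule: step_pair.induct) (auto simp: indicator_def)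

lemma step_pair_measurable:
  assumes "step_pair t G A" "t \<le> T"
  shows "(\<lambda>(\<omega>, s). G s \<omega>) \<in> borel_measurable (M \<Otimes>\<^sub>M lborel)" "A \<in> borel_measurable M"
proof -
  have "(\<lambda>(\<omega>, s). G s \<omega>) \<in> borel_measurable (M \<Otimes>\<^sub>M lborel) \<and> A \<in> borel_measurable M"
    using assms(1)
  proof induction
    case step_pair_zero
    then show ?case by simp
  next
    case (step_pair_piece G A a \<xi> b)
    have ab: "0 \<le> a" "a \<le> T" "0 \<le> b" "b \<le> T"
      using step_pair_piece.hyps(3-5) assms(2) by linarith+
    have [measurable]: "\<xi> \<in> borel_measurable M"
      using step_pair_piece.hyps(2) measurable_F_M ab(1,2) unfolding bounded_at_def by blast
    note [measurable] = W_measurable[OF ab(1,2)] W_measurable[OF ab(3,4)]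
    have G: "(\<lambda>p. G (snd p) (fst p)) \<in> borel_measurable (M \<Otimes>\<^sub>M lborel)"
      and [measurable]: "A \<in> borel_measurable M"
      using step_pair_piece.IH by (simp_all add: case_prod_beta')
    have "(\<lambda>p. \<xi> (fst p)) \<in> borel_measurable (M \<Otimes>\<^sub>M lborel)"
      by (rule measurable_compose[OF measurable_fst]) measurable
    moreover have "(\<lambda>p. indicator {a<..b} (snd p) :: real) \<in> borel_measurable (M \<Otimes>\<^sub>M lborel)"
      by (rule measurable_compose[OF measurable_snd]) measurable
    ultimately have "(\<lambda>p. G (snd p) (fst p) + \<xi> (fst p) * indicator {a<..b} (snd p))
        \<in> borel_measurable (M \<Otimes>\<^sub>M lborel)"
      using G by (intro borel_measurable_add borel_measurable_times)
    moreover have "(\<lambda>\<omega>. A \<omega> + \<xi> \<omega> * (W b \<omega> - W a \<omega>)) \<in> borel_measurable M"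
      by measurable
    ultimately show ?case
      by (simp add: case_prod_beta')
  qed
  then show "(\<lambda>(\<omega>, s). G s \<omega>) \<in> borel_measurable (M \<Otimes>\<^sub>M lborel)" "A \<in> borel_measurable M"
    by simp_all
qed

text \<open>The isometry in polarised form, against a single piece: by linearity in \<open>(G, A)\<close> it reduces to
  \<open>increment_product\<close>. The integrability claims are carried along because the induction adds
  integrals.\<close>

lemma step_pair_times_piece:
  assumes "step_pair t G A" and \<eta>: "bounded_at c \<eta>" and le: "0 \<le> c" "c \<le> d" "d \<le> t" "t \<le> T"
  shows "(\<forall>\<omega>. integrable lborel (\<lambda>s. G s \<omega> * (\<eta> \<omega> * indicator {c<..d} s))) \<and>
    integrable M (\<lambda>\<omega>. A \<omega> * (\<eta> \<omega> * (W d \<omega> - W c \<omega>))) \<and>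
    has_bochner_integral M (\<lambda>\<omega>. LINT s|lborel. G s \<omega> * (\<eta> \<omega> * indicator {c<..d} s))
      (expectation (\<lambda>\<omega>. A \<omega> * (\<eta> \<omega> * (W d \<omega> - W c \<omega>))))"
  using assms(1)
proof induction
  case step_pair_zero
  then show ?case by (simp add: has_bochner_integral_zero)
next
  case (step_pair_piece G A a \<xi> b)
  let ?o = "max 0 (min b d - max a c)"
  let ?P = "\<lambda>\<omega>. (\<xi> \<omega> * (W b \<omega> - W a \<omega>)) * (\<eta> \<omega> * (W d \<omega> - W c \<omega>))"
  have piece: "has_bochner_integral lborel
      (\<lambda>s. (\<xi> \<omega> * indicator {a<..b} s) * (\<eta> \<omega> * indicator {c<..d} s)) (\<xi> \<omega> * \<eta> \<omega> * ?o)" for \<omega>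
    using has_bochner_integral_mult_right[OF interval_overlap_integral[of a b c d], of "\<xi> \<omega> * \<eta> \<omega>"]
    by (simp add: mult.assoc mult.left_commute)
  have prod: "has_bochner_integral M ?P (expectation (\<lambda>\<omega>. \<xi> \<omega> * \<eta> \<omega>) * ?o)"
    using increment_product[OF step_pair_piece.hyps(2) \<eta>] step_pair_piece.hyps le by simp
  have aT: "a \<le> T" and cT: "c \<le> T" and mT: "max a c \<le> T" using step_pair_piece.hyps le by auto
  have "bounded_at (max a c) (\<lambda>\<omega>. \<xi> \<omega> * \<eta> \<omega>)"
    using bounded_at_mono[OF step_pair_piece.hyps(2), of "max a c"] bounded_at_mono[OF \<eta>, of "max a c"]
      step_pair_piece.hyps(3) le(1) mT by (intro bounded_at_mult) simp_all
  then have "integrable M (\<lambda>\<omega>. \<xi> \<omega> * \<eta> \<omega>)"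
    using bounded_at_integrable[of "max a c"] le(1) mT by simp
  then have ov: "has_bochner_integral M (\<lambda>\<omega>. \<xi> \<omega> * \<eta> \<omega> * ?o) (expectation (\<lambda>\<omega>. \<xi> \<omega> * \<eta> \<omega>) * ?o)"
    by (simp add: has_bochner_integral_iff)
  note IH = step_pair_piece.IH
  have int: "has_bochner_integral lborel
      (\<lambda>s. (G s \<omega> + \<xi> \<omega> * indicator {a<..b} s) * (\<eta> \<omega> * indicator {c<..d} s))
      ((LINT s|lborel. G s \<omega> * (\<eta> \<omega> * indicator {c<..d} s)) + \<xi> \<omega> * \<eta> \<omega> * ?o)" for \<omega>
    using has_bochner_integral_add[OF has_bochner_integral_integrable[OF IH[THEN conjunct1, rule_format, of \<omega>]] piece[of \<omega>]]
    by (simp only: distrib_right)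
  have A: "has_bochner_integral M (\<lambda>\<omega>. (A \<omega> + \<xi> \<omega> * (W b \<omega> - W a \<omega>)) * (\<eta> \<omega> * (W d \<omega> - W c \<omega>)))
      (expectation (\<lambda>\<omega>. A \<omega> * (\<eta> \<omega> * (W d \<omega> - W c \<omega>))) + expectation (\<lambda>\<omega>. \<xi> \<omega> * \<eta> \<omega>) * ?o)"
    using has_bochner_integral_add[OF has_bochner_integral_integrable[OF IH[THEN conjunct2, THEN conjunct1]] prod]
    by (simp only: distrib_right)
  have Q: "has_bochner_integral M
      (\<lambda>\<omega>. (LINT s|lborel. G s \<omega> * (\<eta> \<omega> * indicator {c<..d} s)) + \<xi> \<omega> * \<eta> \<omega> * ?o)
      (expectation (\<lambda>\<omega>. A \<omega> * (\<eta> \<omega> * (W d \<omega> - W c \<omega>))) + expectation (\<lambda>\<omega>. \<xi> \<omega> * \<eta> \<omega>) * ?o)"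
    using has_bochner_integral_add[OF IH[THEN conjunct2, THEN conjunct2] ov] .
  show ?case
    unfolding has_bochner_integral_integral_eq[OF int] has_bochner_integral_integral_eq[OF A]
    using int A Q by (auto simp only: has_bochner_integral_iff)
qed

text \<open>Adding a piece expands the square into three terms: the induction hypothesis, a cross term, and
  the square of the piece. The last two are instances of \<open>step_pair_times_piece\<close>.\<close>

lemma step_pair_isometry_real:
  assumes "step_pair t G A" "t \<le> T"
  shows "(\<forall>\<omega>. integrable lborel (\<lambda>s. (G s \<omega>)\<^sup>2)) \<and> integrable M (\<lambda>\<omega>. (A \<omega>)\<^sup>2) \<and>
    has_bochner_integral M (\<lambda>\<omega>. LINT s|lborel. (G s \<omega>)\<^sup>2) (expectation (\<lambda>\<omega>. (A \<omega>)\<^sup>2))"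
  using assms(1)
proof induction
  case step_pair_zero
  then show ?case by (simp add: has_bochner_integral_zero)
next
  case (step_pair_piece G A a \<xi> b)
  note IH = step_pair_piece.IH
  let ?p = "\<lambda>s \<omega>. \<xi> \<omega> * indicator {a<..b} s" and ?P = "\<lambda>\<omega>. \<xi> \<omega> * (W b \<omega> - W a \<omega>)"
  note X = step_pair_times_piece[OF step_pair_piece.hyps(1-5) assms(2)]
  have "step_pair t (\<lambda>s \<omega>. 0 + ?p s \<omega>) (\<lambda>\<omega>. 0 + ?P \<omega>)"
    using step_pair.step_pair_piece[OF step_pair_zero step_pair_piece.hyps(2-5)] .
  from step_pair_times_piece[OF this step_pair_piece.hyps(2-5) assms(2)]
  have Y: "(\<forall>\<omega>. integrable lborel (\<lambda>s. (?p s \<omega>)\<^sup>2)) \<and> integrable M (\<lambda>\<omega>. (?P \<omega>)\<^sup>2) \<and>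
    has_bochner_integral M (\<lambda>\<omega>. LINT s|lborel. (?p s \<omega>)\<^sup>2) (expectation (\<lambda>\<omega>. (?P \<omega>)\<^sup>2))"
    by (simp add: power2_eq_square)
  have sq: "(x + y)\<^sup>2 = x\<^sup>2 + 2 * (x * y) + y\<^sup>2" for x y :: real
    by (simp add: power2_sum)
  have int: "has_bochner_integral lborel (\<lambda>s. (G s \<omega> + ?p s \<omega>)\<^sup>2)
     ((LINT s|lborel. (G s \<omega>)\<^sup>2) + 2 * (LINT s|lborel. G s \<omega> * ?p s \<omega>) + (LINT s|lborel. (?p s \<omega>)\<^sup>2))" for \<omega>
    unfolding sq using IH X Y
    by (intro has_bochner_integral_add has_bochner_integral_mult_right has_bochner_integral_integrable) auto
  have A: "has_bochner_integral M (\<lambda>\<omega>. (A \<omega> + ?P \<omega>)\<^sup>2)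
     (expectation (\<lambda>\<omega>. (A \<omega>)\<^sup>2) + 2 * expectation (\<lambda>\<omega>. A \<omega> * ?P \<omega>) + expectation (\<lambda>\<omega>. (?P \<omega>)\<^sup>2))"
    unfolding sq using IH X Y
    by (intro has_bochner_integral_add has_bochner_integral_mult_right has_bochner_integral_integrable) auto
  have Q: "has_bochner_integral M (\<lambda>\<omega>. (LINT s|lborel. (G s \<omega>)\<^sup>2) +
        2 * (LINT s|lborel. G s \<omega> * ?p s \<omega>) + (LINT s|lborel. (?p s \<omega>)\<^sup>2))
     (expectation (\<lambda>\<omega>. (A \<omega>)\<^sup>2) + 2 * expectation (\<lambda>\<omega>. A \<omega> * ?P \<omega>) + expectation (\<lambda>\<omega>. (?P \<omega>)\<^sup>2))"
    using IH X Y by (intro has_bochner_integral_add has_bochner_integral_mult_right) auto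
  show ?case
    unfolding has_bochner_integral_integral_eq[OF int] has_bochner_integral_integral_eq[OF A]
    using int A Q by (auto simp only: has_bochner_integral_iff)
qed

lemma step_pair_isometry:
  assumes "step_pair t G A" "t \<le> T"
  shows "(\<integral>\<^sup>+\<omega>. ennreal ((A \<omega>)\<^sup>2) \<partial>M)
    = (\<integral>\<^sup>+\<omega>. (\<integral>\<^sup>+s\<in>{0..t}. ennreal ((G s \<omega>)\<^sup>2) \<partial>lborel) \<partial>M)"
proof -
  note I = step_pair_isometry_real[OF assms]
  have "(\<integral>\<^sup>+s\<in>{0..t}. ennreal ((G s \<omega>)\<^sup>2) \<partial>lborel) = (\<integral>\<^sup>+s. ennreal ((G s \<omega>)\<^sup>2) \<partial>lborel)" for \<omega>
    using step_pair_support[OF assms(1)] by (intro nn_integral_cong) (auto simp: indicator_def)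
  moreover have "(\<integral>\<^sup>+s. ennreal ((G s \<omega>)\<^sup>2) \<partial>lborel) = ennreal (LINT s|lborel. (G s \<omega>)\<^sup>2)" for \<omega>
    using I by (intro nn_integral_eq_integral) auto
  moreover have "(\<integral>\<^sup>+\<omega>. ennreal (LINT s|lborel. (G s \<omega>)\<^sup>2) \<partial>M) = ennreal (expectation (\<lambda>\<omega>. (A \<omega>)\<^sup>2))"
    using I nn_integral_eq_integral[of M "\<lambda>\<omega>. LINT s|lborel. (G s \<omega>)\<^sup>2"]
    by (auto simp: has_bochner_integral_iff)
  moreover have "(\<integral>\<^sup>+\<omega>. ennreal ((A \<omega>)\<^sup>2) \<partial>M) = ennreal (expectation (\<lambda>\<omega>. (A \<omega>)\<^sup>2))"
    using I by (intro nn_integral_eq_integral) auto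
  ultimately show ?thesis by simp
qed

end

section \<open>Mean-square closure: integrals of deterministic functions\<close>

definition mean_square :: "'b measure \<Rightarrow> ('b \<Rightarrow> real) \<Rightarrow> ennreal" where
  "mean_square N f = (\<integral>\<^sup>+x. ennreal ((f x)\<^sup>2) \<partial>N)"

lemma mean_square_add_le:
  assumes [measurable]: "f \<in> borel_measurable N" "g \<in> borel_measurable N"
  shows "mean_square N (\<lambda>x. f x + g x) \<le> 2 * mean_square N f + 2 * mean_square N g"
proof -
  have "ennreal ((f x + g x)\<^sup>2) \<le> 2 * ennreal ((f x)\<^sup>2) + 2 * ennreal ((g x)\<^sup>2)" for x
  proof -
    have "(f x + g x)\<^sup>2 \<le> 2 * (f x)\<^sup>2 + 2 * (g x)\<^sup>2"
      using zero_le_power2[of "f x - g x"] by (simp add: power2_sum power2_diff)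
    then have "ennreal ((f x + g x)\<^sup>2) \<le> ennreal (2 * (f x)\<^sup>2 + 2 * (g x)\<^sup>2)"
      by (rule ennreal_leI)
    then show ?thesis by (simp add: ennreal_plus ennreal_mult)
  qed
  then have "mean_square N (\<lambda>x. f x + g x) \<le> (\<integral>\<^sup>+x. 2 * ennreal ((f x)\<^sup>2) + 2 * ennreal ((g x)\<^sup>2) \<partial>N)"
    unfolding mean_square_def by (intro nn_integral_mono)
  also have "\<dots> = 2 * mean_square N f + 2 * mean_square N g"
    unfolding mean_square_def by (subst nn_integral_add) (auto simp: nn_integral_cmult)
  finally show ?thesis .
qed

lemma mean_square_cmult:
  assumes [measurable]: "f \<in> borel_measurable N"
  shows "mean_square N (\<lambda>x. c * f x) = ennreal (c\<^sup>2) * mean_square N f"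
  unfolding mean_square_def
  by (subst nn_integral_cmult[symmetric]) (auto simp: power_mult_distrib ennreal_mult)

lemma ennreal_twice_less:
  assumes "x < ennreal (e / 4)" "y < ennreal (e / 4)" "0 < e"
  shows "2 * x + 2 * y < ennreal e"
proof -
  obtain a where a: "x = ennreal a" "0 \<le> a" using assms(1) by (cases x) auto
  obtain b where b: "y = ennreal b" "0 \<le> b" using assms(2) by (cases y) auto
  have "2 * x + 2 * y = ennreal (2 * a + 2 * b)"
    using a b by (simp add: ennreal_plus ennreal_mult)
  also have "\<dots> < ennreal e"
    using assms a b by (intro ennreal_lessI) (auto simp: ennreal_less_iff)
  finally show ?thesis .
qed

context brownian_space begin

text \<open>The squared norm in which the integrands of the Ito integral are approximated.\<close>

definition path_error :: "real \<Rightarrow> (real \<Rightarrow> 'a \<Rightarrow> real) \<Rightarrow> ennreal" where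
  "path_error t U = (\<integral>\<^sup>+\<omega>. (\<integral>\<^sup>+s\<in>{0..t}. ennreal ((U s \<omega>)\<^sup>2) \<partial>lborel) \<partial>M)"

definition jointly_measurable :: "(real \<Rightarrow> 'a \<Rightarrow> real) \<Rightarrow> bool" where
  "jointly_measurable U \<longleftrightarrow> (\<lambda>p. U (snd p) (fst p)) \<in> borel_measurable (M \<Otimes>\<^sub>M lborel)"

text \<open>By Tonelli's theorem the iterated integral is a mean square over the product space, so that
  \<open>mean_square_add_le\<close> and \<open>mean_square_cmult\<close> apply to it as well. Joint measurability cannot be
  dropped here, as the integral of a non-measurable function is only superadditive.\<close>

lemma path_error_eq_mean_square:
  assumes "jointly_measurable U"
  shows "path_error t U
    = mean_square (M \<Otimes>\<^sub>M lborel) (\<lambda>p. U (snd p) (fst p) * indicator {0..t} (snd p))"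
proof -
  have [measurable]: "(\<lambda>p. U (snd p) (fst p)) \<in> borel_measurable (M \<Otimes>\<^sub>M lborel)"
    using assms by (simp add: jointly_measurable_def)
  have "ennreal ((U s \<omega> * indicator {0..t} s)\<^sup>2) = ennreal ((U s \<omega>)\<^sup>2) * indicator {0..t} s" for s \<omega>
    by (auto simp: indicator_def)
  then show ?thesis
    unfolding path_error_def mean_square_def
    by (subst lborel.nn_integral_fst[symmetric]) auto
qed

lemma jointly_measurable_add:
  "jointly_measurable U \<Longrightarrow> jointly_measurable V \<Longrightarrow> jointly_measurable (\<lambda>s \<omega>. U s \<omega> + V s \<omega>)"
  and jointly_measurable_diff:
  "jointly_measurable U \<Longrightarrow> jointly_measurable V \<Longrightarrow> jointly_measurable (\<lambda>s \<omega>. U s \<omega> - V s \<omega>)"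
  and jointly_measurable_cmult:
  "jointly_measurable U \<Longrightarrow> jointly_measurable (\<lambda>s \<omega>. c * U s \<omega>)"
  by (simp_all add: jointly_measurable_def)

lemma jointly_measurable_deterministic:
  assumes "h \<in> borel_measurable lborel"
  shows "jointly_measurable (\<lambda>s \<omega>. h s)"
  unfolding jointly_measurable_def by (rule measurable_compose[OF measurable_snd assms])

lemma jointly_measurable_step: "step_pair t G A \<Longrightarrow> t \<le> T \<Longrightarrow> jointly_measurable G"
  using step_pair_measurable(1) by (simp add: jointly_measurable_def case_prod_beta')

lemma path_error_add_le:
  assumes "jointly_measurable U" "jointly_measurable V"
  shows "path_error t (\<lambda>s \<omega>. U s \<omega> + V s \<omega>) \<le> 2 * path_error t U + 2 * path_error t V"
proof -
  have m: "(\<lambda>p. U (snd p) (fst p) * indicator {0..t} (snd p)) \<in> borel_measurable (M \<Otimes>\<^sub>M lborel)"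
    if "jointly_measurable U" for U
    using that unfolding jointly_measurable_def
    by (intro borel_measurable_times measurable_compose[OF measurable_snd borel_measurable_indicator]) auto
  show ?thesis
    using mean_square_add_le[OF m[OF assms(1)] m[OF assms(2)]] assms
    by (simp only: path_error_eq_mean_square jointly_measurable_add distrib_right)
qed

lemma path_error_cmult:
  assumes "jointly_measurable U"
  shows "path_error t (\<lambda>s \<omega>. c * U s \<omega>) = ennreal (c\<^sup>2) * path_error t U"
proof -
  have m: "(\<lambda>p. U (snd p) (fst p) * indicator {0..t} (snd p)) \<in> borel_measurable (M \<Otimes>\<^sub>M lborel)"
    using assms unfolding jointly_measurable_def
    by (intro borel_measurable_times measurable_compose[OF measurable_snd borel_measurable_indicator]) auto
  show ?thesis
    using mean_square_cmult[OF m, of c] assms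
    by (simp only: path_error_eq_mean_square jointly_measurable_cmult mult.assoc)
qed

lemma path_error_minus: "path_error t (\<lambda>s \<omega>. U s \<omega> - V s \<omega>) = path_error t (\<lambda>s \<omega>. V s \<omega> - U s \<omega>)"
  unfolding path_error_def by (simp add: power2_commute)

lemma path_error_deterministic:
  "path_error t (\<lambda>s \<omega>. h s) = (\<integral>\<^sup>+s\<in>{0..t}. ennreal ((h s)\<^sup>2) \<partial>lborel)"
  unfolding path_error_def by (simp add: emeasure_space_1)

text \<open>Closure of the step pairs in mean square, for a deterministic integrand. Phrased with an error
  bound rather than with sequences, linearity needs no choice of approximating sequences.\<close>

definition wiener_integral :: "real \<Rightarrow> (real \<Rightarrow> real) \<Rightarrow> ('a \<Rightarrow> real) \<Rightarrow> bool" where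
  "wiener_integral t h J \<longleftrightarrow> h \<in> borel_measurable lborel \<and> J \<in> borel_measurable M \<and>
     (\<forall>e>0. \<exists>G A. step_pair t G A \<and> path_error t (\<lambda>s \<omega>. h s - G s \<omega>) < ennreal e \<and>
        mean_square M (\<lambda>\<omega>. J \<omega> - A \<omega>) < ennreal e)"

lemma wiener_integral_add:
  assumes J: "wiener_integral t h J" and Y: "wiener_integral t g Y" and t: "t \<le> T"
  shows "wiener_integral t (\<lambda>s. h s + g s) (\<lambda>\<omega>. J \<omega> + Y \<omega>)"
proof -
  have [measurable]: "h \<in> borel_measurable lborel" "g \<in> borel_measurable lborel"
    "J \<in> borel_measurable M" "Y \<in> borel_measurable M"
    using J Y by (simp_all add: wiener_integral_def)
  note jm = jointly_measurable_deterministic[of h] jointly_measurable_deterministic[of g]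
  have "\<exists>G A. step_pair t G A \<and> path_error t (\<lambda>s \<omega>. h s + g s - G s \<omega>) < ennreal e \<and>
        mean_square M (\<lambda>\<omega>. J \<omega> + Y \<omega> - A \<omega>) < ennreal e" if "0 < e" for e
  proof -
    have e4: "0 < e / 4" using that by simp
    obtain G A where 1: "step_pair t G A" "path_error t (\<lambda>s \<omega>. h s - G s \<omega>) < ennreal (e / 4)"
        "mean_square M (\<lambda>\<omega>. J \<omega> - A \<omega>) < ennreal (e / 4)"
      using J e4 unfolding wiener_integral_def by blast
    obtain G' B where 2: "step_pair t G' B" "path_error t (\<lambda>s \<omega>. g s - G' s \<omega>) < ennreal (e / 4)"
        "mean_square M (\<lambda>\<omega>. Y \<omega> - B \<omega>) < ennreal (e / 4)"
      using Y e4 unfolding wiener_integral_def by blast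
    have "path_error t (\<lambda>s \<omega>. (h s - G s \<omega>) + (g s - G' s \<omega>))
        \<le> 2 * path_error t (\<lambda>s \<omega>. h s - G s \<omega>) + 2 * path_error t (\<lambda>s \<omega>. g s - G' s \<omega>)"
      using jm jointly_measurable_step[OF 1(1) t] jointly_measurable_step[OF 2(1) t]
      by (intro path_error_add_le jointly_measurable_diff) auto
    also have "\<dots> < ennreal e" using 1 2 that by (intro ennreal_twice_less)
    finally have p: "path_error t (\<lambda>s \<omega>. (h s - G s \<omega>) + (g s - G' s \<omega>)) < ennreal e" .
    have "mean_square M (\<lambda>\<omega>. (J \<omega> - A \<omega>) + (Y \<omega> - B \<omega>))
        \<le> 2 * mean_square M (\<lambda>\<omega>. J \<omega> - A \<omega>) + 2 * mean_square M (\<lambda>\<omega>. Y \<omega> - B \<omega>)"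
      using step_pair_measurable(2)[OF 1(1) t] step_pair_measurable(2)[OF 2(1) t]
      by (intro mean_square_add_le) auto
    also have "\<dots> < ennreal e" using 1 2 that by (intro ennreal_twice_less)
    finally have m: "mean_square M (\<lambda>\<omega>. (J \<omega> - A \<omega>) + (Y \<omega> - B \<omega>)) < ennreal e" .
    show ?thesis
      using step_pair_add[OF 1(1) 2(1)] p m by (auto simp: algebra_simps)
  qed
  then show ?thesis unfolding wiener_integral_def by auto
qed

lemma wiener_integral_scale:
  assumes J: "wiener_integral t h J" and t: "t \<le> T"
  shows "wiener_integral t (\<lambda>s. c * h s) (\<lambda>\<omega>. c * J \<omega>)"
proof -
  have [measurable]: "h \<in> borel_measurable lborel" "J \<in> borel_measurable M"
    using J by (simp_all add: wiener_integral_def)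
  have "\<exists>G A. step_pair t G A \<and> path_error t (\<lambda>s \<omega>. c * h s - G s \<omega>) < ennreal e \<and>
        mean_square M (\<lambda>\<omega>. c * J \<omega> - A \<omega>) < ennreal e" if "0 < e" for e
  proof -
    have pos: "0 < c\<^sup>2 + 1" by (simp add: add_nonneg_pos)
    then have e4: "0 < e / (c\<^sup>2 + 1)" using that by simp
    have scale: "ennreal (c\<^sup>2) * x < ennreal e" if x: "x < ennreal (e / (c\<^sup>2 + 1))" for x
    proof -
      obtain a where a: "x = ennreal a" "0 \<le> a" using x by (cases x) auto
      then have "a < e / (c\<^sup>2 + 1)" using x by (simp add: ennreal_less_iff)
      then have "(c\<^sup>2 + 1) * a < e" using pos by (simp add: field_simps)
      then have "c\<^sup>2 * a < e" using a(2) by (simp add: distrib_right)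
      then show ?thesis using a by (simp add: ennreal_mult[symmetric] ennreal_less_iff)
    qed
    obtain G A where 1: "step_pair t G A" "path_error t (\<lambda>s \<omega>. h s - G s \<omega>) < ennreal (e / (c\<^sup>2 + 1))"
        "mean_square M (\<lambda>\<omega>. J \<omega> - A \<omega>) < ennreal (e / (c\<^sup>2 + 1))"
      using J e4 unfolding wiener_integral_def by blast
    have "path_error t (\<lambda>s \<omega>. c * (h s - G s \<omega>)) < ennreal e"
      using jointly_measurable_diff[OF jointly_measurable_deterministic[of h] jointly_measurable_step[OF 1(1) t]]
        scale[OF 1(2)] by (simp add: path_error_cmult)
    moreover have "mean_square M (\<lambda>\<omega>. c * (J \<omega> - A \<omega>)) < ennreal e"
      using step_pair_measurable(2)[OF 1(1) t] scale[OF 1(3)] by (simp add: mean_square_cmult)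
    ultimately show ?thesis
      using step_pair_scale[OF 1(1), of c] by (auto simp: algebra_simps)
  qed
  then show ?thesis using J unfolding wiener_integral_def by auto
qed

text \<open>\<open>(x + y)\<^sup>2 \<le> 2 x\<^sup>2 + 2 y\<^sup>2\<close> is used twice, once for \<open>J = (J - A) + A\<close> and once for
  \<open>G = h + (G - h)\<close>, with the isometry for \<open>(G, A)\<close> in between; this gives the factor 4.\<close>

lemma wiener_integral_mean_square_le:
  assumes J: "wiener_integral t h J" and t: "t \<le> T"
  shows "mean_square M J \<le> 4 * (\<integral>\<^sup>+s\<in>{0..t}. ennreal ((h s)\<^sup>2) \<partial>lborel)"
proof (rule ennreal_le_epsilon)
  fix e :: real assume "0 < e"
  then have e6: "0 < e / 6" by simp
  have [measurable]: "h \<in> borel_measurable lborel" "J \<in> borel_measurable M"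
    using J by (simp_all add: wiener_integral_def)
  obtain G A where 1: "step_pair t G A" "path_error t (\<lambda>s \<omega>. h s - G s \<omega>) < ennreal (e / 6)"
      "mean_square M (\<lambda>\<omega>. J \<omega> - A \<omega>) < ennreal (e / 6)"
    using J e6 unfolding wiener_integral_def by blast
  note jh = jointly_measurable_deterministic[of h]
  have "mean_square M J = mean_square M (\<lambda>\<omega>. (J \<omega> - A \<omega>) + A \<omega>)" by simp
  also have "\<dots> \<le> 2 * mean_square M (\<lambda>\<omega>. J \<omega> - A \<omega>) + 2 * mean_square M A"
    using step_pair_measurable(2)[OF 1(1) t] by (intro mean_square_add_le) auto
  also have "mean_square M A = path_error t G"
    unfolding mean_square_def path_error_def by (rule step_pair_isometry[OF 1(1) t])
  also have "path_error t G = path_error t (\<lambda>s \<omega>. h s + (G s \<omega> - h s))" by simp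
  also have "2 * mean_square M (\<lambda>\<omega>. J \<omega> - A \<omega>) + 2 * \<dots>
      \<le> 2 * mean_square M (\<lambda>\<omega>. J \<omega> - A \<omega>) +
        2 * (2 * path_error t (\<lambda>s \<omega>. h s) + 2 * path_error t (\<lambda>s \<omega>. G s \<omega> - h s))"
    using jh jointly_measurable_step[OF 1(1) t]
    by (intro add_left_mono mult_left_mono path_error_add_le jointly_measurable_diff) auto
  also have "\<dots> \<le> 2 * ennreal (e / 6) +
      2 * (2 * path_error t (\<lambda>s \<omega>. h s) + 2 * ennreal (e / 6))"
    using 1(2,3) unfolding path_error_minus[of t G]
    by (intro add_mono mult_left_mono) auto
  also have "\<dots> = 4 * path_error t (\<lambda>s \<omega>. h s) + 6 * ennreal (e / 6)"
    by (simp add: distrib_left mult.assoc[symmetric] add.commute add.left_commute distrib_right[symmetric])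
  also have "6 * ennreal (e / 6) = ennreal e"
    using ennreal_mult[of 6 "e / 6"] \<open>0 < e\<close> by simp
  finally show "mean_square M J \<le> 4 * (\<integral>\<^sup>+s\<in>{0..t}. ennreal ((h s)\<^sup>2) \<partial>lborel) + ennreal e"
    by (simp add: path_error_deterministic)
qed

lemma wiener_integral_of_ito:
  assumes ito: "has_ito_integral M F W t H J"
    and eq: "AE \<omega> in M. \<forall>s\<in>{0..t}. H s \<omega> = h s"
    and h: "h \<in> borel_measurable lborel" and t: "t \<le> T"
  shows "wiener_integral t h J"
proof -
  obtain n \<tau> \<xi> where simple: "\<And>k. simple_integrand M F t (n k) (\<tau> k) (\<xi> k)"
    and G: "(\<lambda>k. \<integral>\<^sup>+\<omega>. (\<integral>\<^sup>+s\<in>{0..t}.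
      ennreal ((H s \<omega> - simple_process (n k) (\<tau> k) (\<xi> k) s \<omega>)\<^sup>2) \<partial>lborel) \<partial>M) \<longlonglongrightarrow> 0"
    and A: "(\<lambda>k. \<integral>\<^sup>+\<omega>. ennreal ((J \<omega> - simple_ito W (n k) (\<tau> k) (\<xi> k) \<omega>)\<^sup>2) \<partial>M) \<longlonglongrightarrow> 0"
    and J: "J \<in> borel_measurable M"
    using ito unfolding has_ito_integral_def by blast
  have "\<exists>G A. step_pair t G A \<and> path_error t (\<lambda>s \<omega>. h s - G s \<omega>) < ennreal e \<and>
        mean_square M (\<lambda>\<omega>. J \<omega> - A \<omega>) < ennreal e" if "0 < e" for e
  proof -
    have e: "0 < ennreal e" using that by simp
    obtain k where k: "(\<integral>\<^sup>+\<omega>. (\<integral>\<^sup>+s\<in>{0..t}.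
          ennreal ((H s \<omega> - simple_process (n k) (\<tau> k) (\<xi> k) s \<omega>)\<^sup>2) \<partial>lborel) \<partial>M) < ennreal e"
        "(\<integral>\<^sup>+\<omega>. ennreal ((J \<omega> - simple_ito W (n k) (\<tau> k) (\<xi> k) \<omega>)\<^sup>2) \<partial>M) < ennreal e"
      using eventually_happens'[OF _ eventually_conj[OF order_tendstoD(2)[OF G e] order_tendstoD(2)[OF A e]]]
      by auto
    have "path_error t (\<lambda>s \<omega>. h s - simple_process (n k) (\<tau> k) (\<xi> k) s \<omega>)
      = (\<integral>\<^sup>+\<omega>. (\<integral>\<^sup>+s\<in>{0..t}.
          ennreal ((H s \<omega> - simple_process (n k) (\<tau> k) (\<xi> k) s \<omega>)\<^sup>2) \<partial>lborel) \<partial>M)"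
      unfolding path_error_def
    proof (rule nn_integral_cong_AE, use eq in eventually_elim)
      case (elim \<omega>)
      then show ?case by (intro nn_integral_cong) (auto simp: indicator_def)
    qed
    then have "path_error t (\<lambda>s \<omega>. h s - simple_process (n k) (\<tau> k) (\<xi> k) s \<omega>) < ennreal e"
      using k(1) by simp
    then show ?thesis
      using step_pair_simple[OF simple[of k] t] k(2) unfolding mean_square_def by blast
  qed
  then show ?thesis using h J unfolding wiener_integral_def by simp
qed

lemma wiener_integral_cong_AE:
  assumes J: "wiener_integral t h J" and eq: "AE \<omega> in M. J' \<omega> = J \<omega>" and "J' \<in> borel_measurable M"
  shows "wiener_integral t h J'"
proof -
  have "mean_square M (\<lambda>\<omega>. J' \<omega> - A \<omega>) = mean_square M (\<lambda>\<omega>. J \<omega> - A \<omega>)" for A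
    unfolding mean_square_def using eq by (intro nn_integral_cong_AE) (auto elim: eventually_mono)
  then show ?thesis using J assms(3) unfolding wiener_integral_def by simp
qed

lemma wiener_integral_sum:
  fixes N :: nat
  assumes "\<And>n. wiener_integral t (g n) (Y n)" "t \<le> T"
  shows "wiener_integral t (\<lambda>s. \<Sum>n<N. g n s) (\<lambda>\<omega>. \<Sum>n<N. Y n \<omega>)"
proof (induction N)
  case 0
  have "wiener_integral t (\<lambda>s. 0 * g 0 s) (\<lambda>\<omega>. 0 * Y 0 \<omega>)"
    by (rule wiener_integral_scale[OF assms])
  then show ?case by simp
next
  case (Suc N)
  then show ?case using wiener_integral_add[OF _ assms, of _ _ N] by simp
qed

end

section \<open>The signature components that meet the Volterra series\<close>

lemma monomial_integral:
  fixes t :: real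
  assumes "0 \<le> t"
  shows "(LINT s:{0..t}|lborel. s ^ n / fact n) = t ^ Suc n / fact (Suc n)"
proof -
  have "(LINT s|lborel. (s ^ n / fact n) * indicator {0..t} s)
      = t ^ Suc n / fact (Suc n) - 0 ^ Suc n / fact (Suc n)"
  proof (rule integral_FTC_Icc_real[OF assms])
    fix x :: real
    have "((\<lambda>s. s ^ Suc n / fact (Suc n)) has_real_derivative (real (Suc n) * x ^ n) / fact (Suc n)) (at x)"
      using DERIV_cdivide[OF DERIV_pow[of "Suc n" x], of "fact (Suc n)"] by simp
    then show "((\<lambda>s. s ^ Suc n / fact (Suc n)) has_real_derivative x ^ n / fact n) (at x)"
      by (simp add: field_simps del: of_nat_Suc)
    show "isCont (\<lambda>s. s ^ n / fact n) x" by (intro continuous_intros) auto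
  qed
  then show ?thesis by (simp add: set_lebesgue_integral_def mult.commute)
qed

lemma monomial_mono: "mono_on {0..t} (\<lambda>s::real. s ^ n / fact n)"
  by (auto simp: mono_on_def intro!: divide_right_mono power_mono)

text \<open>The increments of \<open>z\<close> are uniformly small by uniform continuity, and those of the monotone
  function \<open>p\<close> are nonnegative and telescope to \<open>p t - p 0\<close>.\<close>

lemma monotone_covariation_sums_tendsto_0:
  fixes p z :: "real \<Rightarrow> real"
  assumes p: "mono_on {0..t} p" and z: "continuous_on {0..t} z" and t: "0 \<le> t"
  shows "(\<lambda>k. \<Sum>i<Suc k. (p (t * real (Suc i) / real (Suc k)) - p (t * real i / real (Suc k))) *
      (z (t * real (Suc i) / real (Suc k)) - z (t * real i / real (Suc k)))) \<longlonglongrightarrow> 0"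
    (is "?Q \<longlonglongrightarrow> 0")
proof (rule LIMSEQ_I)
  fix r :: real assume r: "0 < r"
  \<comment> \<open>The summand \<open>1\<close> makes \<open>V\<close> positive even for constant \<open>p\<close>.\<close>
  define V where "V = p t - p 0 + 1"
  have V: "0 < V" using p t unfolding V_def mono_on_def by force
  have "uniformly_continuous_on {0..t} z"
    using z by (rule compact_uniformly_continuous) simp
  then obtain d where d: "0 < d"
    "\<And>x y. x \<in> {0..t} \<Longrightarrow> y \<in> {0..t} \<Longrightarrow> dist y x < d \<Longrightarrow> dist (z y) (z x) < r / V"
    unfolding uniformly_continuous_on_def using r V by (metis divide_pos_pos)
  obtain N where N: "t / d < real N" using reals_Archimedean2 by blast
  have "norm (?Q k - 0) < r" if "N \<le> k" for k
  proof -
    let ?\<tau> = "\<lambda>i. t * real i / real (Suc k)"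
    have mesh: "?\<tau> (Suc i) - ?\<tau> i = t / real (Suc k)" for i
      by (simp add: diff_divide_distrib[symmetric] distrib_left)
    have small: "t / real (Suc k) < d"
    proof -
      have "t / d < real (Suc k)" using N that by linarith
      then show ?thesis using d(1) by (simp add: field_simps)
    qed
    have in_t: "?\<tau> i \<in> {0..t}" if "i \<le> Suc k" for i
    proof -
      have "t * real i \<le> t * real (Suc k)"
        using that t by (intro mult_left_mono) auto
      then show ?thesis using t by (simp add: pos_divide_le_eq)
    qed
    have le: "?\<tau> i \<le> ?\<tau> (Suc i)" for i
      using mesh[of i] t by (metis diff_ge_0_iff_ge divide_nonneg_nonneg of_nat_0_le_iff)
    have dp: "0 \<le> p (?\<tau> (Suc i)) - p (?\<tau> i)" if "i < Suc k" for i
      using mono_onD[OF p in_t[of i] in_t[of "Suc i"] le] that by simp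
    have dz: "\<bar>z (?\<tau> (Suc i)) - z (?\<tau> i)\<bar> \<le> r / V" if "i < Suc k" for i
    proof -
      have "dist (?\<tau> (Suc i)) (?\<tau> i) < d"
        using mesh[of i] small le[of i] by (simp add: dist_real_def)
      then show ?thesis
        using d(2)[OF in_t[of i] in_t[of "Suc i"]] that by (simp add: dist_real_def less_imp_le)
    qed
    have "\<bar>?Q k\<bar> \<le> (\<Sum>i<Suc k. \<bar>(p (?\<tau> (Suc i)) - p (?\<tau> i)) * (z (?\<tau> (Suc i)) - z (?\<tau> i))\<bar>)"
      by (rule sum_abs)
    also have "\<dots> \<le> (\<Sum>i<Suc k. (p (?\<tau> (Suc i)) - p (?\<tau> i)) * (r / V))"
    proof (rule sum_mono)
      fix i assume "i \<in> {..<Suc k}"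
      then have i: "i < Suc k" by simp
      show "\<bar>(p (?\<tau> (Suc i)) - p (?\<tau> i)) * (z (?\<tau> (Suc i)) - z (?\<tau> i))\<bar>
          \<le> (p (?\<tau> (Suc i)) - p (?\<tau> i)) * (r / V)"
        unfolding abs_mult abs_of_nonneg[OF dp[OF i]]
        by (rule mult_left_mono[OF dz[OF i] dp[OF i]])
    qed
    also have "\<dots> = (p (?\<tau> (Suc k)) - p (?\<tau> 0)) * (r / V)"
      unfolding sum_distrib_right[symmetric]
      using sum_lessThan_telescope[of "\<lambda>i. p (?\<tau> i)" "Suc k"] by simp
    also have "\<dots> = (p t - p 0) * (r / V)" by simp
    also have "\<dots> < V * (r / V)"
      using r V by (intro mult_strict_right_mono) (auto simp: V_def)
    also have "\<dots> = r" using V by simp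
    finally show ?thesis by simp
  qed
  then show "\<exists>N. \<forall>k\<ge>N. norm (?Q k - 0) < r" by blast
qed

context brownian_space begin

text \<open>The null sets of countably many times can be united; a countable dense set of times determines a
  continuous path.\<close>

lemma continuous_process_indistinguishable:
  assumes Y: "continuous_process M T Y" and p: "continuous_on {0..T} p"
    and eq: "\<And>t. t \<in> {0..T} \<Longrightarrow> AE \<omega> in M. Y t \<omega> = p t"
  shows "AE \<omega> in M. \<forall>t\<in>{0..T}. Y t \<omega> = p t"
proof -
  obtain D where D: "countable D" "D \<subseteq> {0..T}" "{0..T} \<subseteq> closure D"
    using separable by blast
  have "AE \<omega> in M. \<forall>t\<in>D. Y t \<omega> = p t"
    using D eq by (intro AE_ball_countable[THEN iffD2]) auto
  then show ?thesis
    using Y[unfolded continuous_process_def]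
  proof eventually_elim
    case (elim \<omega>)
    show ?case
    proof
      fix t assume t: "t \<in> {0..T}"
      then obtain x where x: "\<And>n. x n \<in> D" "x \<longlonglongrightarrow> t"
        using D(3) closure_sequential[of t D] by auto
      have xT: "\<forall>\<^sub>F n in sequentially. x n \<in> {0..T}"
        using x(1) D(2) by (blast intro: always_eventually)
      have "(\<lambda>n. Y (x n) \<omega>) \<longlonglongrightarrow> Y t \<omega>"
        using continuous_on_tendsto_compose[OF elim(2) x(2) t xT] .
      moreover have "(\<lambda>n. Y (x n) \<omega>) \<longlonglongrightarrow> p t"
        using continuous_on_tendsto_compose[OF p x(2) t xT] x(1) elim(1) by simp
      ultimately show "Y t \<omega> = p t" by (rule LIMSEQ_unique)
    qed
  qed
qed

text \<open>Along the uniform partitions the sums tend to \<open>0\<close> almost surely and to \<open>C\<close> in probability. The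
  two modes of convergence are compared through the expectation of \<open>min 1 \<bar>Q - C\<bar>\<close>, which dominated
  convergence handles and which is at most \<open>r\<close> once \<open>\<bar>Q - C\<bar> > r / 2\<close> has probability below \<open>r / 2\<close>.\<close>

lemma covariation_with_monotone_eq_0:
  assumes C: "has_covariation M Y Z t C" and t: "0 \<le> t" "t \<le> T"
    and p: "mono_on {0..t} p" and Yp: "AE \<omega> in M. \<forall>s\<in>{0..t}. Y s \<omega> = p s"
    and Z: "AE \<omega> in M. continuous_on {0..t} (\<lambda>s. Z s \<omega>)"
    and meas: "\<And>s. s \<in> {0..t} \<Longrightarrow> Y s \<in> borel_measurable M" "\<And>s. s \<in> {0..t} \<Longrightarrow> Z s \<in> borel_measurable M"
  shows "AE \<omega> in M. C \<omega> = 0"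
proof -
  define \<tau> where "\<tau> k i = t * real i / real (Suc k)" for k i
  define Q where "Q k \<omega> = (\<Sum>i<Suc k. (Y (\<tau> k (Suc i)) \<omega> - Y (\<tau> k i) \<omega>) *
      (Z (\<tau> k (Suc i)) \<omega> - Z (\<tau> k i) \<omega>))" for k \<omega>
  have in_t: "\<tau> k i \<in> {0..t}" if "i \<le> Suc k" for k i
  proof -
    have "t * real i \<le> t * real (Suc k)"
      using that t by (intro mult_left_mono) auto
    then show ?thesis using t by (simp add: \<tau>_def pos_divide_le_eq)
  qed
  have [measurable]: "C \<in> borel_measurable M" using C by (simp add: has_covariation_def)
  have [measurable]: "Q k \<in> borel_measurable M" for k
    unfolding Q_def[abs_def]
    by (intro borel_measurable_sum borel_measurable_times borel_measurable_diff meas in_t) simp_all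
  have lim: "AE \<omega> in M. (\<lambda>k. Q k \<omega>) \<longlonglongrightarrow> 0"
    using Yp Z
  proof eventually_elim
    case (elim \<omega>)
    have "Q k \<omega> = (\<Sum>i<Suc k. (p (\<tau> k (Suc i)) - p (\<tau> k i)) * (Z (\<tau> k (Suc i)) \<omega> - Z (\<tau> k i) \<omega>))" for k
      unfolding Q_def using elim(1) in_t by (intro sum.cong refl) auto
    then show ?case
      using monotone_covariation_sums_tendsto_0[OF p elim(2) t(1)] unfolding \<tau>_def by simp
  qed
  define e where "e k = expectation (\<lambda>\<omega>. min 1 \<bar>Q k \<omega> - C \<omega>\<bar>)" for k
  have e_lim: "e \<longlonglongrightarrow> expectation (\<lambda>\<omega>. min 1 \<bar>C \<omega>\<bar>)"
    unfolding e_def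
  proof (rule integral_dominated_convergence[where w = "\<lambda>_. 1"])
    show "AE \<omega> in M. (\<lambda>k. min 1 \<bar>Q k \<omega> - C \<omega>\<bar>) \<longlonglongrightarrow> min 1 \<bar>C \<omega>\<bar>"
      using lim
    proof eventually_elim
      case (elim \<omega>)
      have "(\<lambda>k. min 1 \<bar>Q k \<omega> - C \<omega>\<bar>) \<longlonglongrightarrow> min 1 \<bar>0 - C \<omega>\<bar>"
        by (intro tendsto_intros elim)
      then show ?case by simp
    qed
  qed auto
  have "expectation (\<lambda>\<omega>. min 1 \<bar>C \<omega>\<bar>) \<le> 0"
  proof (rule field_le_epsilon)
    fix r :: real assume r: "0 < r"
    then have "0 < r / 2" by simp
    with C obtain d where d: "0 < d" "\<And>n \<tau>. partition_mesh_less t d n \<tau> \<Longrightarrow>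
        measure M {\<omega> \<in> space M. \<bar>(\<Sum>i<n. (Y (\<tau> (Suc i)) \<omega> - Y (\<tau> i) \<omega>) *
          (Z (\<tau> (Suc i)) \<omega> - Z (\<tau> i) \<omega>)) - C \<omega>\<bar> > r / 2} < r / 2"
      unfolding has_covariation_def by blast
    obtain N where N: "t / d < real N" using reals_Archimedean2 by blast
    have "e k \<le> r" if k: "N \<le> k" for k
    proof -
      let ?A = "{\<omega> \<in> space M. \<bar>Q k \<omega> - C \<omega>\<bar> > r / 2}"
      have mesh: "\<tau> k (Suc i) - \<tau> k i = t / real (Suc k)" for i
        by (simp add: \<tau>_def diff_divide_distrib[symmetric] distrib_left)
      have "t / d < real (Suc k)" using N k by linarith
      then have "t / real (Suc k) < d" using d(1) by (simp add: field_simps)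
      moreover have "0 \<le> t / real (Suc k)" using t by simp
      ultimately have "partition_mesh_less t d (Suc k) (\<tau> k)"
        unfolding partition_mesh_less_def
        using mesh by (auto simp: \<tau>_def) (metis diff_ge_0_iff_ge)
      from d(2)[OF this] have A: "prob ?A < r / 2" unfolding Q_def .
      have "e k \<le> expectation (\<lambda>\<omega>. r / 2 + indicator ?A \<omega>)"
        unfolding e_def
      proof (rule integral_mono)
        show "integrable M (\<lambda>\<omega>. min 1 \<bar>Q k \<omega> - C \<omega>\<bar>)"
          by (rule integrable_const_bound[where B = 1]) auto
        show "integrable M (\<lambda>\<omega>. r / 2 + indicat_real ?A \<omega>)"
          by (intro Bochner_Integration.integrable_add) (auto simp: emeasure_eq_measure)
        show "min 1 \<bar>Q k \<omega> - C \<omega>\<bar> \<le> r / 2 + indicator ?A \<omega>" if "\<omega> \<in> space M" for \<omega>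
          using that r by (auto simp: indicator_def min_def)
      qed
      also have "\<dots> = r / 2 + prob ?A"
        by (subst Bochner_Integration.integral_add) (auto simp: emeasure_eq_measure prob_space)
      finally show ?thesis using A by simp
    qed
    then have "expectation (\<lambda>\<omega>. min 1 \<bar>C \<omega>\<bar>) \<le> r"
      using LIMSEQ_le_const2[OF e_lim] by blast
    then show "expectation (\<lambda>\<omega>. min 1 \<bar>C \<omega>\<bar>) \<le> 0 + r" by simp
  qed
  then have "expectation (\<lambda>\<omega>. min 1 \<bar>C \<omega>\<bar>) = 0"
    by (intro antisym) (auto intro!: integral_nonneg_AE)
  moreover have "integrable M (\<lambda>\<omega>. min 1 \<bar>C \<omega>\<bar>)"
    by (rule integrable_const_bound[where B = 1]) auto
  ultimately have "AE \<omega> in M. min 1 \<bar>C \<omega>\<bar> = 0"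
    using integral_nonneg_eq_0_iff_AE[of M "\<lambda>\<omega>. min 1 \<bar>C \<omega>\<bar>"] by auto
  then show ?thesis
    by eventually_elim (auto simp: min_def split: if_splits)
qed

context
  fixes S :: "word \<Rightarrow> real \<Rightarrow> 'a \<Rightarrow> real"
  assumes S: "is_signature M F T W S"
begin

lemma signature_measurable: "0 \<le> t \<Longrightarrow> t \<le> T \<Longrightarrow> S v t \<in> borel_measurable M"
  using S measurable_F_M unfolding is_signature_def adapted_process_def by (meson atLeastAtMost_iff)

text \<open>The next integration is along the whole path, so the value has to be known at all times
  simultaneously and not only at each fixed time.\<close>

lemma signature_path:
  assumes "\<And>t. t \<in> {0..T} \<Longrightarrow> AE \<omega> in M. S (replicate n Letter1) t \<omega> = t ^ n / fact n"
  shows "AE \<omega> in M. \<forall>t\<in>{0..T}. S (replicate n Letter1) t \<omega> = t ^ n / fact n"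
  using S assms unfolding is_signature_def
  by (intro continuous_process_indistinguishable continuous_intros) auto

lemma signature_covariation:
  assumes path: "AE \<omega> in M. \<forall>t\<in>{0..T}. S (replicate n Letter1) t \<omega> = t ^ n / fact n"
    and C: "has_covariation M (S (replicate n Letter1)) (augmented W i) t C" and t: "0 \<le> t" "t \<le> T"
  shows "AE \<omega> in M. C \<omega> = 0"
proof (rule covariation_with_monotone_eq_0[OF C t monomial_mono[of t n]])
  show "AE \<omega> in M. \<forall>s\<in>{0..t}. S (replicate n Letter1) s \<omega> = s ^ n / fact n"
    using path by eventually_elim (use t in auto)
  have W: "AE \<omega> in M. continuous_on {0..T} (\<lambda>s. W s \<omega>)"
    using brownian by (simp add: brownian_motion_def continuous_process_def)
  show "AE \<omega> in M. continuous_on {0..t} (\<lambda>s. augmented W i s \<omega>)"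
  proof (cases i)
    case Letter1
    then show ?thesis by simp
  next
    case Letter2
    then show ?thesis
      using W t(2) by (auto elim!: eventually_mono continuous_on_subset)
  qed
  show "S (replicate n Letter1) s \<in> borel_measurable M" if "s \<in> {0..t}" for s
    using that t by (intro signature_measurable) auto
  show "augmented W i s \<in> borel_measurable M" if "s \<in> {0..t}" for s
  proof (cases i)
    case Letter1
    then have "augmented W i s = (\<lambda>\<omega>. s)" by auto
    then show ?thesis by simp
  next
    case Letter2
    then have "augmented W i s = W s" by auto
    then show ?thesis using W_measurable that t by simp
  qed
qed

text \<open>The letter \<open>2\<close> does not occur, so every integration is an ordinary one along the time axis; the
  only trace of the Stratonovich convention is a covariation with time, which vanishes.\<close>

lemma signature_time_words:
  "AE \<omega> in M. \<forall>t\<in>{0..T}. S (replicate n Letter1) t \<omega> = t ^ n / fact n"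
proof (induction n)
  case 0
  show ?case
    using S by (intro signature_path) (auto simp: is_signature_def)
next
  case (Suc n)
  show ?case
  proof (rule signature_path)
    fix t assume t: "t \<in> {0..T}"
    then have "has_stratonovich_integral M F W Letter1 t (S (replicate n Letter1))
        (S (replicate n Letter1 @ [Letter1]) t)"
      using S unfolding is_signature_def by blast
    then obtain J C where
      J: "AE \<omega> in M. set_integrable lborel {0..t} (\<lambda>s. S (replicate n Letter1) s \<omega>) \<and>
          J \<omega> = (LINT s:{0..t}|lborel. S (replicate n Letter1) s \<omega>)"
      and C: "has_covariation M (S (replicate n Letter1)) (augmented W Letter1) t C"
      and I: "AE \<omega> in M. S (replicate n Letter1 @ [Letter1]) t \<omega> = J \<omega> + C \<omega> / 2"
      unfolding has_stratonovich_integral_def by auto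
    have "AE \<omega> in M. C \<omega> = 0"
      using signature_covariation[OF Suc C] t by simp
    with J I Suc show "AE \<omega> in M. S (replicate (Suc n) Letter1) t \<omega> = t ^ Suc n / fact (Suc n)"
    proof eventually_elim
      case (elim \<omega>)
      have "(LINT s:{0..t}|lborel. S (replicate n Letter1) s \<omega>) = (LINT s:{0..t}|lborel. s ^ n / fact n)"
        using elim(3) t by (intro set_lebesgue_integral_cong) auto
      also have "\<dots> = t ^ Suc n / fact (Suc n)"
        using t by (intro monomial_integral) auto
      finally show ?case
        using elim by (simp add: replicate_append_same del: power_Suc fact_Suc)
    qed
  qed
qed

lemma signature_wiener_integral:
  assumes t: "0 \<le> t" "t \<le> T"
  shows "wiener_integral t (\<lambda>s. s ^ n / fact n) (S (replicate n Letter1 @ [Letter2]) t)"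
proof -
  have "has_stratonovich_integral M F W Letter2 t (S (replicate n Letter1))
      (S (replicate n Letter1 @ [Letter2]) t)"
    using S t unfolding is_signature_def by (meson atLeastAtMost_iff)
  then obtain J C where J: "has_ito_integral M F W t (S (replicate n Letter1)) J"
    and C: "has_covariation M (S (replicate n Letter1)) (augmented W Letter2) t C"
    and I: "AE \<omega> in M. S (replicate n Letter1 @ [Letter2]) t \<omega> = J \<omega> + C \<omega> / 2"
    unfolding has_stratonovich_integral_def by auto
  have "AE \<omega> in M. \<forall>s\<in>{0..t}. S (replicate n Letter1) s \<omega> = s ^ n / fact n"
    using signature_time_words[of n] by eventually_elim (use t in auto)
  then have "wiener_integral t (\<lambda>s. s ^ n / fact n) J"
    by (rule wiener_integral_of_ito[OF J]) (use t in auto)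
  moreover have "AE \<omega> in M. C \<omega> = 0"
    by (rule signature_covariation[OF signature_time_words C t])
  with I have "AE \<omega> in M. S (replicate n Letter1 @ [Letter2]) t \<omega> = J \<omega>"
    by eventually_elim simp
  ultimately show ?thesis
    using signature_measurable[OF t] by (rule wiener_integral_cong_AE)
qed

end

end

section \<open>Taylor expansion of the kernel\<close>

text \<open>The rate at which the Taylor remainder decays; writing \<open>q\<close> as the square of its root reduces the
  claim to the decay of \<open>m p\<^sup>m\<close>.\<close>

lemma quadratic_geometric_tendsto_0:
  fixes q :: real
  assumes q: "0 \<le> q" "q < 1"
  shows "(\<lambda>m. q ^ m * (real (Suc m) * sqrt (2 * real (Suc m) + 1))) \<longlonglongrightarrow> 0"
proof -
  let ?p = "sqrt q"
  have p: "norm ?p < 1" using q by simp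
  have "(\<lambda>m. real m * ?p ^ m + ?p ^ m) \<longlonglongrightarrow> 0 + 0"
    using powser_times_n_limit_0[OF p] LIMSEQ_power_zero[OF p] by (intro tendsto_add)
  then have "(\<lambda>m. 2 * (real m * ?p ^ m + ?p ^ m)\<^sup>2) \<longlonglongrightarrow> 2 * (0 + 0)\<^sup>2"
    by (intro tendsto_mult[OF tendsto_const] tendsto_power)
  then have lim: "(\<lambda>m. 2 * (real m * ?p ^ m + ?p ^ m)\<^sup>2) \<longlonglongrightarrow> 0" by simp
  have "q ^ m * (real (Suc m) * sqrt (2 * real (Suc m) + 1)) \<le> 2 * (real m * ?p ^ m + ?p ^ m)\<^sup>2" for m
  proof -
    have "2 * real (Suc m) + 1 \<le> (2 * real (Suc m))\<^sup>2"
      by (simp add: power2_eq_square algebra_simps)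
    then have "sqrt (2 * real (Suc m) + 1) \<le> 2 * real (Suc m)"
      by (intro real_le_lsqrt) auto
    then have "q ^ m * (real (Suc m) * sqrt (2 * real (Suc m) + 1)) \<le> q ^ m * (real (Suc m) * (2 * real (Suc m)))"
      using q by (intro mult_left_mono) auto
    also have "\<dots> = (?p ^ m)\<^sup>2 * (real (Suc m) * (2 * real (Suc m)))"
      using q by (simp add: power_mult[symmetric] mult.commute[of m] power_mult)
    also have "\<dots> = 2 * (real m * ?p ^ m + ?p ^ m)\<^sup>2"
      by (simp add: power2_eq_square algebra_simps)
    finally show ?thesis .
  qed
  then show ?thesis
    using q by (intro tendsto_sandwich[OF _ _ tendsto_const lim]) (auto intro!: always_eventually)
qed

text \<open>With \<open>u = t - x\<close> and \<open>q = s / t\<close>, the remainder after \<open>m + 1\<close> terms is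
  \<open>\<integral>\<^sub>0\<^sup>s (s - x)\<^sup>m / m! (-1)\<^bsup>m+1\<^esup> K\<^bsup>(m+1)\<^esup>(u) dx\<close>, and \<open>s - x \<le> q u\<close> together with \<open>u \<ge> t - s > 0\<close> bounds the
  integrand by \<open>q\<^sup>m\<close> times the summand of index \<open>m + 1\<close> in \<open>fin\<close>, up to a factor that grows polynomially
  in \<open>m\<close>. All these summands have integral at most that of the whole series.\<close>

lemma taylor_series_sums_kernel:
  fixes K :: "real \<Rightarrow> real" and D :: "nat \<Rightarrow> real \<Rightarrow> real"
  assumes D: "has_derivatives_on K D {0<..T}"
    and fin: "(\<integral>\<^sup>+u\<in>{0<..T}.
      (\<Sum>n. ennreal (\<bar>D n u\<bar> * u powr (real n + 1/2) / (fact n * sqrt (2 * real n + 1)))) \<partial>lborel) < \<infinity>"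
    and st: "0 \<le> s" "s < t" "t \<le> T"
  shows "(\<lambda>n. D n t * (-1) ^ n * (s ^ n / fact n)) sums K (t - s)"
proof -
  define g where "g n u = \<bar>D n u\<bar> * u powr (real n + 1/2) / (fact n * sqrt (2 * real n + 1))" for n u
  define r where "r = t - s"
  define q where "q = s / t"
  have r: "0 < r" and q: "0 \<le> q" "q < 1" using st by (auto simp: r_def q_def)
  have cont_D: "continuous_on {0<..T} (D n)" for n
    using D unfolding has_derivatives_on_def
    by (intro DERIV_continuous_on[where D = "D (Suc n)"]) auto
  have cont_g: "continuous_on {0<..T} (g n)" for n
    unfolding g_def by (intro continuous_intros cont_D) auto
  define X where "X = (\<integral>\<^sup>+u\<in>{0<..T}. (\<Sum>n. ennreal (g n u)) \<partial>lborel)"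
  have "X < \<infinity>" using fin unfolding X_def g_def .
  then obtain C where C: "0 \<le> C" "X = ennreal C" by (cases X) auto
  have g_nonneg: "0 \<le> g n u" for n u by (simp add: g_def)
  have sub: "t - x \<in> {0<..T}" if "x \<in> {0..s}" for x using that st by auto
  have cont_gt: "continuous_on {0..s} (\<lambda>x. g n (t - x))" for n
    by (intro continuous_on_compose2[OF cont_g] continuous_intros image_subsetI sub)
  have g_int: "integral {0..s} (\<lambda>x. g n (t - x)) \<le> C" for n
  proof -
    have si: "set_integrable lborel {0..s} (\<lambda>x. g n (t - x))"
      by (rule borel_integrable_atLeastAtMost'[OF cont_gt])
    have "ennreal (integral {0..s} (\<lambda>x. g n (t - x))) = ennreal (LINT x:{0..s}|lborel. g n (t - x))"
      using set_borel_integral_eq_integral(2)[OF si] by simp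
    also have "\<dots> = (\<integral>\<^sup>+x. ennreal (indicator {0..s} x * g n (t - x)) \<partial>lborel)"
      using si g_nonneg unfolding set_lebesgue_integral_def set_integrable_def
      by (subst nn_integral_eq_integral) auto
    also have "\<dots> \<le> (\<integral>\<^sup>+x. ennreal (indicator {0<..T} (t + - 1 * x) * g n (t + - 1 * x)) \<partial>lborel)"
      using sub by (intro nn_integral_mono ennreal_leI mult_right_mono g_nonneg)
         (auto simp: indicator_def g_nonneg)
    also have "\<dots> = (\<integral>\<^sup>+u. ennreal (indicator {0<..T} u * g n u) \<partial>lborel)"
    proof -
      have "(\<lambda>u. indicator {0<..T} u * g n u) \<in> borel_measurable borel"
        using borel_measurable_continuous_on_indicator[OF _ cont_g[of n]] by simp
      then show ?thesis
        using nn_integral_real_affine[of "\<lambda>u. ennreal (indicator {0<..T} u * g n u)" "- 1" t] by simp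
    qed
    also have "\<dots> \<le> (\<integral>\<^sup>+u\<in>{0<..T}. (\<Sum>n. ennreal (g n u)) \<partial>lborel)"
    proof (rule nn_integral_mono)
      fix u :: real
      have "ennreal (g n u) \<le> (\<Sum>n. ennreal (g n u))"
        using sum_le_suminf[of "\<lambda>n. ennreal (g n u)" "{n}"] by simp
      then show "ennreal (indicator {0<..T} u * g n u) \<le> (\<Sum>n. ennreal (g n u)) * indicator {0<..T} u"
        by (auto simp: indicator_def)
    qed
    also have "\<dots> = ennreal C" using C(2) unfolding X_def .
    finally show ?thesis using C(1) by simp
  qed
  define b where "b m = r powr (-3/2) * (q ^ m * (real (Suc m) * sqrt (2 * real (Suc m) + 1))) * C" for m
  have "\<bar>K (t - s) - (\<Sum>n<Suc m. D n t * (-1) ^ n * (s ^ n / fact n))\<bar> \<le> b m" for m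
  proof -
    \<comment> \<open>Taylor's formula expands around the left end of an interval; reflection moves \<open>t\<close> there.\<close>
    define E where "E n x = (-1) ^ n * D n (t - x)" for n x
    define i where "i x = ((s - x) ^ (Suc m - 1) / fact (Suc m - 1)) *\<^sub>R E (Suc m) x" for x
    have dE: "(E n has_vector_derivative E (Suc n) x) (at x within {0..s})" if "0 \<le> x" "x \<le> s" for n x
    proof -
      have "(D n has_real_derivative D (Suc n) (t - x)) (at (t - x) within (\<lambda>x. t - x) ` {0..s})"
      proof (rule DERIV_subset)
        have "t - x \<in> {0<..T}" using that by (intro sub) simp
        then show "(D n has_real_derivative D (Suc n) (t - x)) (at (t - x) within {0<..T})"
          using D unfolding has_derivatives_on_def by blast
        show "(\<lambda>x. t - x) ` {0..s} \<subseteq> {0<..T}" by (intro image_subsetI sub)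
      qed
      then have "(D n \<circ> (\<lambda>x. t - x) has_real_derivative D (Suc n) (t - x) * (- 1)) (at x within {0..s})"
        by (rule DERIV_image_chain) (auto intro!: derivative_eq_intros)
      then have "((\<lambda>x. (-1) ^ n * D n (t - x)) has_real_derivative (-1) ^ n * (D (Suc n) (t - x) * (- 1)))
          (at x within {0..s})"
        unfolding comp_def by (rule DERIV_cmult)
      then show ?thesis
        unfolding E_def has_real_derivative_iff_has_vector_derivative by simp
    qed
    have taylor: "E 0 s = (\<Sum>n<Suc m. ((s - 0) ^ n / fact n) *\<^sub>R E n 0) + integral {0..s} i"
      unfolding i_def by (rule Taylor_integral) (use dE st in auto)
    have "E 0 s = K (t - s)"
      using D sub[of s] st by (auto simp: E_def has_derivatives_on_def)
    then have "K (t - s) - (\<Sum>n<Suc m. D n t * (-1) ^ n * (s ^ n / fact n)) = integral {0..s} i"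
      using taylor by (simp add: E_def algebra_simps)
    also have "norm (integral {0..s} i) \<le> integral {0..s} (\<lambda>x. r powr (-3/2) *
        (q ^ m * (real (Suc m) * sqrt (2 * real (Suc m) + 1))) * g (Suc m) (t - x))"
    proof (rule integral_norm_bound_integral)
      show "i integrable_on {0..s}"
        unfolding i_def by (rule Taylor_integrable) (use dE st in auto)
      show "(\<lambda>x. r powr (-3/2) * (q ^ m * (real (Suc m) * sqrt (2 * real (Suc m) + 1))) *
          g (Suc m) (t - x)) integrable_on {0..s}"
        by (intro integrable_continuous_real continuous_intros cont_gt)
      fix x assume x: "x \<in> {0..s}"
      define u where "u = t - x"
      have u: "0 < u" "r \<le> u" using x st by (auto simp: u_def r_def)
      have "s * x \<le> t * x" using x st by (intro mult_right_mono) auto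
      then have "s - x \<le> q * u" using st by (simp add: q_def u_def field_simps)
      then have "(s - x) ^ m \<le> (q * u) ^ m" using x by (intro power_mono) auto
      also have "\<dots> = q ^ m * (u powr (real (Suc m) + 1/2) * u powr (-3/2))"
        using u by (simp add: power_mult_distrib powr_add[symmetric] powr_realpow)
      also have "\<dots> \<le> q ^ m * (u powr (real (Suc m) + 1/2) * r powr (-3/2))"
        using q r u by (intro mult_left_mono powr_mono2') auto
      finally have *: "(s - x) ^ m \<le> q ^ m * (u powr (real (Suc m) + 1/2) * r powr (-3/2))" .
      have "norm (i x) = (s - x) ^ m * (\<bar>D (Suc m) u\<bar> / fact m)"
        using x by (simp add: i_def E_def u_def abs_mult)
      also have "\<dots> \<le> q ^ m * (u powr (real (Suc m) + 1/2) * r powr (-3/2)) * (\<bar>D (Suc m) u\<bar> / fact m)"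
        by (intro mult_right_mono *) auto
      also have "\<dots> = r powr (-3/2) * (q ^ m * (real (Suc m) * sqrt (2 * real (Suc m) + 1))) * g (Suc m) u"
      proof -
        have "sqrt (2 * real (Suc m) + 1) \<noteq> 0" by simp
        then have eq: "\<bar>D (Suc m) u\<bar> / fact m * u powr (real (Suc m) + 1/2)
            = real (Suc m) * sqrt (2 * real (Suc m) + 1) * g (Suc m) u"
          unfolding g_def fact_Suc of_nat_mult by (simp del: of_nat_Suc)
        have "q ^ m * (u powr (real (Suc m) + 1/2) * r powr (-3/2)) * (\<bar>D (Suc m) u\<bar> / fact m)
            = r powr (-3/2) * q ^ m * (\<bar>D (Suc m) u\<bar> / fact m * u powr (real (Suc m) + 1/2))"
          by (simp only: mult_ac)
        then show ?thesis unfolding eq by (simp only: mult_ac)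
      qed
      finally show "norm (i x) \<le> r powr (-3/2) * (q ^ m * (real (Suc m) * sqrt (2 * real (Suc m) + 1)))
          * g (Suc m) (t - x)"
        by (simp add: u_def)
    qed
    also have "\<dots> = r powr (-3/2) * (q ^ m * (real (Suc m) * sqrt (2 * real (Suc m) + 1))) *
        integral {0..s} (\<lambda>x. g (Suc m) (t - x))"
      by simp
    also have "\<dots> \<le> b m"
      unfolding b_def using q by (intro mult_left_mono g_int) auto
    finally show ?thesis by simp
  qed
  then have bound: "\<forall>\<^sub>F m in sequentially.
      norm (K (t - s) - (\<Sum>n<Suc m. D n t * (-1) ^ n * (s ^ n / fact n))) \<le> b m"
    by (intro always_eventually allI) (simp only: real_norm_def)
  have "b \<longlonglongrightarrow> r powr (-3/2) * 0 * C"
    unfolding b_def by (intro tendsto_intros quadratic_geometric_tendsto_0 q)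
  then have "b \<longlonglongrightarrow> 0" by simp
  with bound have "(\<lambda>m. K (t - s) - (\<Sum>n<Suc m. D n t * (-1) ^ n * (s ^ n / fact n))) \<longlonglongrightarrow> 0"
    by (rule Lim_null_comparison)
  then have "(\<lambda>m. K (t - s) - (K (t - s) - (\<Sum>n<Suc m. D n t * (-1) ^ n * (s ^ n / fact n))))
      \<longlonglongrightarrow> K (t - s) - 0"
    by (rule tendsto_diff[OF tendsto_const])
  then have "(\<lambda>m. \<Sum>n<Suc m. D n t * (-1) ^ n * (s ^ n / fact n)) \<longlonglongrightarrow> K (t - s)" by simp
  then show ?thesis unfolding sums_def by (rule LIMSEQ_imp_Suc)
qed

lemma nn_integral_point: "(\<integral>\<^sup>+s\<in>{a..a}. f s \<partial>lborel) = 0" for a :: real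
proof -
  have "AE s in lborel. f s * indicator {a..a} s = 0"
    using AE_lborel_singleton[of a] by eventually_elim (auto simp: indicator_def)
  then have "(\<integral>\<^sup>+s\<in>{a..a}. f s \<partial>lborel) = (\<integral>\<^sup>+s. 0 \<partial>(lborel :: real measure))"
    by (rule nn_integral_cong_AE)
  then show ?thesis by simp
qed

lemma monomial_square_integral:
  fixes t :: real
  assumes "0 \<le> t"
  shows "(\<integral>\<^sup>+s\<in>{0..t}. ennreal ((s ^ n / fact n)\<^sup>2) \<partial>lborel)
    = ennreal ((t powr (real n + 1/2) / (fact n * sqrt (2 * real n + 1)))\<^sup>2)"
proof (cases "t = 0")
  case True
  then show ?thesis using nn_integral_point[where a = 0] by simp
next
  case False
  have "(\<integral>\<^sup>+s\<in>{0..t}. ennreal ((s ^ n / fact n)\<^sup>2) \<partial>lborel)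
      = ennreal (t ^ Suc (2 * n) / (real (Suc (2 * n)) * (fact n)\<^sup>2) - 0 ^ Suc (2 * n) / (real (Suc (2 * n)) * (fact n)\<^sup>2))"
  proof (rule nn_integral_FTC_Icc[OF _ _ _ assms])
    fix x :: real
    have "((\<lambda>s. s ^ Suc (2 * n) / (real (Suc (2 * n)) * (fact n)\<^sup>2)) has_real_derivative
        real (Suc (2 * n)) * x ^ (2 * n) / (real (Suc (2 * n)) * (fact n)\<^sup>2)) (at x)"
      using DERIV_cdivide[OF DERIV_pow[of "Suc (2 * n)" x], of "real (Suc (2 * n)) * (fact n)\<^sup>2"] by simp
    also have "real (Suc (2 * n)) * x ^ (2 * n) / (real (Suc (2 * n)) * (fact n)\<^sup>2) = (x ^ n / fact n)\<^sup>2"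
      by (simp add: power_divide power_mult[symmetric] mult.commute[of n] del: of_nat_Suc)
    finally show "((\<lambda>s. s ^ Suc (2 * n) / (real (Suc (2 * n)) * (fact n)\<^sup>2)) has_real_derivative
        (x ^ n / fact n)\<^sup>2) (at x)" .
  qed auto
  also have "t ^ Suc (2 * n) / (real (Suc (2 * n)) * (fact n)\<^sup>2) - 0 ^ Suc (2 * n) / (real (Suc (2 * n)) * (fact n)\<^sup>2)
      = (t powr (real n + 1/2) / (fact n * sqrt (2 * real n + 1)))\<^sup>2"
  proof -
    have "(t powr (real n + 1/2))\<^sup>2 = t powr real (Suc (2 * n))"
      by (simp add: power2_eq_square powr_add[symmetric] add.commute)
    also have "\<dots> = t ^ Suc (2 * n)"
      using assms False by (intro powr_realpow) simp
    finally show ?thesis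
      by (simp add: power_divide power_mult_distrib mult.commute add.commute)
  qed
  finally show ?thesis .
qed

text \<open>Dominated convergence: every remainder is at most the sum of the absolute values of all terms,
  whose square is integrable by \<open>fin\<close>. The endpoint \<open>s = t\<close>, where the expansion may fail, is a null
  set.\<close>

lemma taylor_square_error_tendsto_0:
  fixes k :: "real \<Rightarrow> real" and a :: "nat \<Rightarrow> real"
  assumes k: "k \<in> borel_measurable lborel"
    and sums: "\<And>s. 0 \<le> s \<Longrightarrow> s < t \<Longrightarrow> (\<lambda>n. a n * (-1) ^ n * (s ^ n / fact n)) sums k s"
    and fin: "(\<integral>\<^sup>+s\<in>{0..t}. (\<Sum>n. ennreal (\<bar>a n\<bar> * s ^ n / fact n))\<^sup>2 \<partial>lborel) < \<infinity>"
  shows "(\<lambda>N. \<integral>\<^sup>+s\<in>{0..t}. ennreal ((k s - (\<Sum>n<N. a n * (-1) ^ n * (s ^ n / fact n)))\<^sup>2) \<partial>lborel)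
    \<longlonglongrightarrow> 0"
proof -
  define w where "w s = (\<Sum>n. ennreal (\<bar>a n\<bar> * s ^ n / fact n))" for s
  define R where "R N s = k s - (\<Sum>n<N. a n * (-1) ^ n * (s ^ n / fact n))" for N s
  have [measurable]: "R N \<in> borel_measurable lborel" for N
    unfolding R_def[abs_def] using k by measurable
  have [measurable]: "w \<in> borel_measurable lborel"
    unfolding w_def[abs_def] by measurable
  \<comment> \<open>Where the absolute series diverges, \<open>w s\<close> is infinite and nothing is claimed.\<close>
  have bound: "ennreal \<bar>R N s\<bar> \<le> w s" if s: "0 \<le> s" "s < t" for N s
  proof (cases "w s = \<infinity>")
    case False
    let ?f = "\<lambda>n. a n * (-1) ^ n * (s ^ n / fact n)"
    have abs_f: "\<bar>?f n\<bar> = \<bar>a n\<bar> * s ^ n / fact n" for n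
      using s by (simp add: abs_mult)
    have sm: "summable (\<lambda>n. \<bar>?f n\<bar>)"
      unfolding abs_f using False s unfolding w_def
      by (intro summable_suminf_not_top) auto
    have sm': "summable (\<lambda>n. \<bar>?f (n + N)\<bar>)"
      using sm by (simp only: summable_iff_shift[of "\<lambda>n. \<bar>?f n\<bar>"])
    have "k s = (\<Sum>n. ?f (n + N)) + (\<Sum>n<N. ?f n)"
      using suminf_split_initial_segment[OF summable_rabs_cancel[OF sm], of N]
        sums_unique[OF sums[OF s]] by simp
    then have "\<bar>R N s\<bar> = \<bar>\<Sum>n. ?f (n + N)\<bar>" unfolding R_def by simp
    also have "\<dots> \<le> (\<Sum>n. \<bar>?f (n + N)\<bar>)" by (rule summable_rabs[OF sm'])
    also have "\<dots> \<le> (\<Sum>n. \<bar>?f n\<bar>)"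
      using suminf_split_initial_segment[OF sm, of N] sum_nonneg[of "{..<N}" "\<lambda>n. \<bar>?f n\<bar>"] by simp
    finally have "ennreal \<bar>R N s\<bar> \<le> ennreal (\<Sum>n. \<bar>?f n\<bar>)" by (rule ennreal_leI)
    also have "\<dots> = w s"
      unfolding w_def abs_f[symmetric] by (rule suminf_ennreal2[symmetric, OF _ sm]) simp
    finally show ?thesis .
  qed simp
  have "(\<lambda>N. \<integral>\<^sup>+s. ennreal ((R N s)\<^sup>2) * indicator {0..t} s \<partial>lborel) \<longlonglongrightarrow> (\<integral>\<^sup>+s. 0 \<partial>(lborel::real measure))"
  proof (rule nn_integral_dominated_convergence[where w = "\<lambda>s. (w s)\<^sup>2 * indicator {0..t} s"])
    show "(\<integral>\<^sup>+s. (w s)\<^sup>2 * indicator {0..t} s \<partial>lborel) < \<infinity>"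
      using fin unfolding w_def .
    show "AE s in lborel. ennreal ((R N s)\<^sup>2) * indicator {0..t} s \<le> (w s)\<^sup>2 * indicator {0..t} s" for N
      using AE_lborel_singleton[of t]
    proof eventually_elim
      case (elim s)
      have "ennreal ((R N s)\<^sup>2) \<le> (w s)\<^sup>2" if "s \<in> {0..t}"
      proof -
        have "(ennreal \<bar>R N s\<bar>)\<^sup>2 \<le> (w s)\<^sup>2"
          using bound[of s N] elim that by (intro power_mono) auto
        moreover have "(ennreal \<bar>R N s\<bar>)\<^sup>2 = ennreal ((R N s)\<^sup>2)"
          by (simp add: ennreal_power)
        ultimately show ?thesis by simp
      qed
      then show ?case by (auto simp: indicator_def)
    qed
    show "AE s in lborel. (\<lambda>N. ennreal ((R N s)\<^sup>2) * indicator {0..t} s) \<longlonglongrightarrow> 0"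
      using AE_lborel_singleton[of t]
    proof eventually_elim
      case (elim s)
      show ?case
      proof (cases "s \<in> {0..t}")
        case True
        then have "(\<lambda>N. R N s) \<longlonglongrightarrow> k s - k s"
          using elim sums[of s] unfolding R_def sums_def by (intro tendsto_diff tendsto_const) auto
        then have "(\<lambda>N. ennreal ((R N s)\<^sup>2)) \<longlonglongrightarrow> ennreal ((k s - k s)\<^sup>2)"
          by (intro tendsto_ennrealI tendsto_power)
        then show ?thesis using True by simp
      qed simp
    qed
  qed measurable
  then show ?thesis unfolding R_def by simp
qed

section \<open>The bracket of the Volterra series\<close>

text \<open>The words \<open>1\<^sup>n2\<close> have different lengths, so each coefficient collects at most one summand, and each
  length contributes at most one word to the bracket.\<close>

lemma volterra_series_words:
  assumes "t \<noteq> 0"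
  shows "volterra_series D t (replicate n Letter1 @ [Letter2]) = D n t * (-1) ^ n"
    and "(\<And>n. v \<noteq> replicate n Letter1 @ [Letter2]) \<Longrightarrow> volterra_series D t v = 0"
proof -
  have inj: "replicate n Letter1 @ [Letter2] = replicate m Letter1 @ [Letter2] \<longleftrightarrow> m = n" for n m
    by (metis length_replicate append_same_eq)
  have "(\<lambda>m. D m t * (-1) ^ m * word_series (replicate m Letter1 @ [Letter2]) (replicate n Letter1 @ [Letter2]))
      = (\<lambda>m. if m = n then D m t * (-1) ^ m else 0)"
    unfolding word_series_def inj by (simp add: fun_eq_iff)
  then show "volterra_series D t (replicate n Letter1 @ [Letter2]) = D n t * (-1) ^ n"
    using assms sums_unique[OF sums_single[of n "\<lambda>m. D m t * (-1) ^ m"]]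
    by (simp add: volterra_series_def)
  show "volterra_series D t v = 0" if "\<And>n. v \<noteq> replicate n Letter1 @ [Letter2]"
    using assms that by (simp add: volterra_series_def word_series_def)
qed

lemma finite_words: "finite (words n)"
proof -
  have "(UNIV :: letter set) = {Letter1, Letter2}"
    using letter.exhaust by auto
  then have "finite (UNIV :: letter set)"
    by (metis finite.emptyI finite.insertI)
  then have "finite {xs. set xs \<subseteq> (UNIV :: letter set) \<and> length xs = n}"
    by (rule finite_lists_length_eq)
  then show ?thesis by (simp add: words_def)
qed

text \<open>The word \<open>1\<^sup>n2\<close> has length \<open>n + 1\<close>; this shifts the index between the derivatives and the levels
  of the bracket.\<close>

lemma bracket_term_volterra_series:
  assumes "t \<noteq> 0"
  shows "bracket_term (volterra_series D t) S 0 = 0"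
    and "bracket_term (volterra_series D t) S (Suc n) = D n t * (-1) ^ n * S (replicate n Letter1 @ [Letter2])"
proof -
  have "words 0 = {[]}" by (auto simp: words_def)
  then show "bracket_term (volterra_series D t) S 0 = 0"
    by (simp add: bracket_term_def volterra_series_words(2)[OF assms])
  let ?w = "replicate n Letter1 @ [Letter2]"
  have "bracket_term (volterra_series D t) S (Suc n) = (\<Sum>v\<in>{?w}. volterra_series D t v * S v)"
    unfolding bracket_term_def
  proof (rule sum.mono_neutral_right[OF finite_words])
    show "{?w} \<subseteq> words (Suc n)" by (simp add: words_def)
    show "\<forall>v\<in>words (Suc n) - {?w}. volterra_series D t v * S v = 0"
    proof
      fix v assume v: "v \<in> words (Suc n) - {?w}"
      have "v \<noteq> replicate m Letter1 @ [Letter2]" for m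
        using v by (auto simp: words_def)
      then show "volterra_series D t v * S v = 0"
        using volterra_series_words(2)[OF assms] by simp
    qed
  qed
  then show "bracket_term (volterra_series D t) S (Suc n) = D n t * (-1) ^ n * S ?w"
    by (simp add: volterra_series_words(1)[OF assms])
qed

lemma bracket_volterra_series:
  assumes t: "t \<noteq> 0" and sm: "summable (\<lambda>n. \<bar>D n t * (-1) ^ n * S (replicate n Letter1 @ [Letter2])\<bar>)"
  shows "bracket_defined (volterra_series D t) S"
    and "bracket (volterra_series D t) S = (\<Sum>n. D n t * (-1) ^ n * S (replicate n Letter1 @ [Letter2]))"
proof -
  have "summable (\<lambda>n. \<bar>bracket_term (volterra_series D t) S (Suc n)\<bar>)"
    using sm by (simp only: bracket_term_volterra_series(2)[OF t])
  then have sb: "summable (\<lambda>n. \<bar>bracket_term (volterra_series D t) S n\<bar>)"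
    by (simp only: summable_Suc_iff[of "\<lambda>n. \<bar>bracket_term (volterra_series D t) S n\<bar>"])
  then show "bracket_defined (volterra_series D t) S" by (simp add: bracket_defined_def)
  show "bracket (volterra_series D t) S = (\<Sum>n. D n t * (-1) ^ n * S (replicate n Letter1 @ [Letter2]))"
    unfolding bracket_def using suminf_split_head[OF summable_rabs_cancel[OF sb]]
    by (simp add: bracket_term_volterra_series[OF t])
qed

section \<open>The Volterra process as a signature series\<close>

text \<open>Summable first moments give almost sure absolute convergence; by Fatou's lemma, the mean square
  of the difference between \<open>X\<close> and the sum is at most the limit of the mean-square errors.\<close>

lemma (in prob_space) series_eq_mean_square_limit:
  fixes X :: "'a \<Rightarrow> real" and Z :: "nat \<Rightarrow> 'a \<Rightarrow> real"
  assumes [measurable]: "X \<in> borel_measurable M" "\<And>n. Z n \<in> borel_measurable M"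
    and fin: "(\<Sum>n. \<integral>\<^sup>+\<omega>. ennreal \<bar>Z n \<omega>\<bar> \<partial>M) < \<infinity>"
    and lim: "(\<lambda>N. mean_square M (\<lambda>\<omega>. X \<omega> - (\<Sum>n<N. Z n \<omega>))) \<longlonglongrightarrow> 0"
  shows "AE \<omega> in M. summable (\<lambda>n. \<bar>Z n \<omega>\<bar>) \<and> X \<omega> = (\<Sum>n. Z n \<omega>)"
proof -
  have "(\<integral>\<^sup>+\<omega>. (\<Sum>n. ennreal \<bar>Z n \<omega>\<bar>) \<partial>M) = (\<Sum>n. \<integral>\<^sup>+\<omega>. ennreal \<bar>Z n \<omega>\<bar> \<partial>M)"
    by (rule nn_integral_suminf) simp
  then have "(\<integral>\<^sup>+\<omega>. (\<Sum>n. ennreal \<bar>Z n \<omega>\<bar>) \<partial>M) \<noteq> \<infinity>"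
    using fin by simp
  then have "AE \<omega> in M. (\<Sum>n. ennreal \<bar>Z n \<omega>\<bar>) \<noteq> \<infinity>"
    by (intro nn_integral_PInf_AE) simp_all
  then have summ: "AE \<omega> in M. summable (\<lambda>n. \<bar>Z n \<omega>\<bar>)"
    by eventually_elim (auto intro!: summable_suminf_not_top)
  have "(\<integral>\<^sup>+\<omega>. liminf (\<lambda>N. ennreal ((X \<omega> - (\<Sum>n<N. Z n \<omega>))\<^sup>2)) \<partial>M)
      \<le> liminf (\<lambda>N. mean_square M (\<lambda>\<omega>. X \<omega> - (\<Sum>n<N. Z n \<omega>)))"
    unfolding mean_square_def by (intro nn_integral_liminf) simp
  also have "\<dots> = 0"
    by (rule lim_imp_Liminf[OF _ lim]) simp
  finally have "AE \<omega> in M. liminf (\<lambda>N. ennreal ((X \<omega> - (\<Sum>n<N. Z n \<omega>))\<^sup>2)) = 0"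
    by (subst nn_integral_0_iff_AE[symmetric]) auto
  with summ show ?thesis
  proof eventually_elim
    case (elim \<omega>)
    have "(\<lambda>N. \<Sum>n<N. Z n \<omega>) \<longlonglongrightarrow> (\<Sum>n. Z n \<omega>)"
      by (rule summable_LIMSEQ[OF summable_rabs_cancel[OF elim(1)]])
    then have "(\<lambda>N. ennreal ((X \<omega> - (\<Sum>n<N. Z n \<omega>))\<^sup>2)) \<longlonglongrightarrow> ennreal ((X \<omega> - (\<Sum>n. Z n \<omega>))\<^sup>2)"
      by (intro tendsto_ennrealI tendsto_power tendsto_diff tendsto_const)
    then have "liminf (\<lambda>N. ennreal ((X \<omega> - (\<Sum>n<N. Z n \<omega>))\<^sup>2)) = ennreal ((X \<omega> - (\<Sum>n. Z n \<omega>))\<^sup>2)"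
      by (intro lim_imp_Liminf) simp_all
    then show ?case using elim by simp
  qed
qed

lemma (in prob_space) mean_abs_le_root_mean_square:
  assumes [measurable]: "Y \<in> borel_measurable M" and c: "0 < c" and ms: "mean_square M Y \<le> ennreal (c\<^sup>2)"
  shows "(\<integral>\<^sup>+\<omega>. ennreal \<bar>Y \<omega>\<bar> \<partial>M) \<le> ennreal c"
proof -
  \<comment> \<open>Young's inequality replaces Cauchy--Schwarz, and takes the square root out of the bound.\<close>
  have le: "\<bar>y\<bar> \<le> 1 / (2 * c) * y\<^sup>2 + c / 2" for y :: real
  proof -
    have "0 \<le> (\<bar>y\<bar> - c)\<^sup>2 / (2 * c)" using c by simp
    also have "\<dots> = 1 / (2 * c) * y\<^sup>2 + c / 2 - \<bar>y\<bar>"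
      using c by (simp add: power2_diff field_simps power2_eq_square)
    finally show ?thesis by simp
  qed
  have "(\<integral>\<^sup>+\<omega>. ennreal \<bar>Y \<omega>\<bar> \<partial>M)
      \<le> (\<integral>\<^sup>+\<omega>. ennreal (1 / (2 * c)) * ennreal ((Y \<omega>)\<^sup>2) + ennreal (c / 2) \<partial>M)"
  proof (rule nn_integral_mono)
    fix \<omega>
    have "ennreal \<bar>Y \<omega>\<bar> \<le> ennreal (1 / (2 * c) * (Y \<omega>)\<^sup>2 + c / 2)" by (rule ennreal_leI[OF le])
    also have "\<dots> = ennreal (1 / (2 * c) * (Y \<omega>)\<^sup>2) + ennreal (c / 2)"
      using c by (intro ennreal_plus) auto
    also have "ennreal (1 / (2 * c) * (Y \<omega>)\<^sup>2) = ennreal (1 / (2 * c)) * ennreal ((Y \<omega>)\<^sup>2)"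
      using c by (intro ennreal_mult) auto
    finally show "ennreal \<bar>Y \<omega>\<bar> \<le> ennreal (1 / (2 * c)) * ennreal ((Y \<omega>)\<^sup>2) + ennreal (c / 2)" .
  qed
  also have "\<dots> = ennreal (1 / (2 * c)) * mean_square M Y + ennreal (c / 2)"
    unfolding mean_square_def
    by (subst nn_integral_add) (simp_all add: nn_integral_cmult emeasure_space_1)
  also have "\<dots> \<le> ennreal (1 / (2 * c)) * ennreal (c\<^sup>2) + ennreal (c / 2)"
    by (intro add_right_mono mult_left_mono ms) simp
  also have "\<dots> = ennreal (1 / (2 * c) * c\<^sup>2 + c / 2)"
    using c by (simp only: ennreal_plus ennreal_mult zero_le_power2 divide_nonneg_nonneg mult_nonneg_nonneg
        zero_le_one less_imp_le zero_le_numeral)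
  also have "1 / (2 * c) * c\<^sup>2 + c / 2 = c"
    using c by (simp add: power2_eq_square)
  finally show ?thesis .
qed

context brownian_space begin

text \<open>Progressive measurability of a deterministic integrand says that it is Borel on \<open>[0, t]\<close> only,
  whence the cut-off.\<close>

lemma volterra_wiener_integral:
  assumes X: "volterra_process M F T W K X" and t: "0 \<le> t" "t \<le> T"
  shows "wiener_integral t (\<lambda>s. indicator {0..t} s * K (t - s)) (X t)"
proof -
  have ito: "has_ito_integral M F W t (\<lambda>s \<omega>. K (t - s)) (X t)"
    using X t unfolding volterra_process_def by simp
  have "progressively_measurable F t (\<lambda>s \<omega>. K (t - s))"
    using ito unfolding has_ito_integral_def by simp
  then have "(\<lambda>(s, \<omega>). K (t - s)) \<in> borel_measurable (restrict_space borel {0..t} \<Otimes>\<^sub>M F t)"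
    using t unfolding progressively_measurable_def by simp
  moreover obtain \<omega> where "\<omega> \<in> space M" using not_empty by blast
  then have \<omega>: "\<omega> \<in> space (F t)" using space_F[of t] t by simp
  ultimately have "(\<lambda>s. K (t - s)) \<in> borel_measurable (restrict_space borel {0..t})"
    using measurable_Pair1[OF _ \<omega>, of "\<lambda>(s, \<omega>). K (t - s)"] by simp
  then have h: "(\<lambda>s. indicator {0..t} s * K (t - s)) \<in> borel_measurable lborel"
    by (simp add: borel_measurable_restrict_space_iff)
  show ?thesis
    by (rule wiener_integral_of_ito[OF ito _ h t(2)]) simp
qed

lemma signature_mean_abs_le:
  assumes S: "is_signature M F T W S" and t: "0 < t" "t \<le> T"
  shows "(\<integral>\<^sup>+\<omega>. ennreal \<bar>S (replicate n Letter1 @ [Letter2]) t \<omega>\<bar> \<partial>M)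
    \<le> ennreal (2 * (t powr (real n + 1/2) / (fact n * sqrt (2 * real n + 1))))"
proof -
  let ?c = "t powr (real n + 1/2) / (fact n * sqrt (2 * real n + 1))"
  have W: "wiener_integral t (\<lambda>s. s ^ n / fact n) (S (replicate n Letter1 @ [Letter2]) t)"
    using signature_wiener_integral[OF S] t by simp
  have "mean_square M (S (replicate n Letter1 @ [Letter2]) t)
      \<le> 4 * (\<integral>\<^sup>+s\<in>{0..t}. ennreal ((s ^ n / fact n)\<^sup>2) \<partial>lborel)"
    by (rule wiener_integral_mean_square_le[OF W t(2)])
  also have "\<dots> = 4 * ennreal (?c\<^sup>2)"
    using t by (subst monomial_square_integral) simp_all
  also have "\<dots> = ennreal ((2 * ?c)\<^sup>2)"
    using ennreal_mult[of 4 "?c\<^sup>2"] unfolding power_mult_distrib by simp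
  finally show ?thesis
    using t by (intro mean_abs_le_root_mean_square signature_measurable[OF S])
               (auto intro!: divide_pos_pos mult_pos_pos)
qed

text \<open>The difference between \<open>X\<^sub>t\<close> and a partial sum is the Ito integral of the corresponding Taylor
  remainder.\<close>

lemma volterra_eq_signature_series:
  fixes D :: "nat \<Rightarrow> real \<Rightarrow> real"
  assumes S: "is_signature M F T W S" and X: "volterra_process M F T W K X"
    and t: "0 < t" "t \<le> T"
    and taylor: "\<And>s. 0 \<le> s \<Longrightarrow> s < t \<Longrightarrow> (\<lambda>n. D n t * (-1) ^ n * (s ^ n / fact n)) sums K (t - s)"
    and fin1: "(\<Sum>n. ennreal (\<bar>D n t\<bar> * t powr (real n + 1/2) / (fact n * sqrt (2 * real n + 1)))) < \<infinity>"
    and fin2: "(\<integral>\<^sup>+s\<in>{0..t}. (\<Sum>n. ennreal (\<bar>D n t\<bar> * s ^ n / fact n))\<^sup>2 \<partial>lborel) < \<infinity>"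
  shows "AE \<omega> in M. summable (\<lambda>n. \<bar>D n t * (-1) ^ n * S (replicate n Letter1 @ [Letter2]) t \<omega>\<bar>) \<and>
    X t \<omega> = (\<Sum>n. D n t * (-1) ^ n * S (replicate n Letter1 @ [Letter2]) t \<omega>)"
proof (rule series_eq_mean_square_limit)
  let ?Y = "\<lambda>n. S (replicate n Letter1 @ [Letter2]) t" and ?a = "\<lambda>n. D n t * (-1) ^ n"
  define k where "k s = indicator {0..t} s * K (t - s)" for s
  have t0: "0 \<le> t" using t by simp
  have WX: "wiener_integral t k (X t)"
    unfolding k_def[abs_def] by (rule volterra_wiener_integral[OF X t0 t(2)])
  have WY: "wiener_integral t (\<lambda>s. ?a n * (s ^ n / fact n)) (\<lambda>\<omega>. ?a n * ?Y n \<omega>)" for n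
    by (rule wiener_integral_scale[OF signature_wiener_integral[OF S t0 t(2)] t(2)])
  show "X t \<in> borel_measurable M" using WX by (simp add: wiener_integral_def)
  show Ym: "(\<lambda>\<omega>. ?a n * ?Y n \<omega>) \<in> borel_measurable M" for n
    using WY[of n] by (simp add: wiener_integral_def)
  show "(\<Sum>n. \<integral>\<^sup>+\<omega>. ennreal \<bar>?a n * ?Y n \<omega>\<bar> \<partial>M) < \<infinity>"
  proof -
    let ?c = "\<lambda>n. t powr (real n + 1/2) / (fact n * sqrt (2 * real n + 1))"
    have "(\<integral>\<^sup>+\<omega>. ennreal \<bar>?a n * ?Y n \<omega>\<bar> \<partial>M)
        \<le> 2 * ennreal (\<bar>D n t\<bar> * t powr (real n + 1/2) / (fact n * sqrt (2 * real n + 1)))" for n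
    proof -
      have "(\<integral>\<^sup>+\<omega>. ennreal \<bar>?a n * ?Y n \<omega>\<bar> \<partial>M) = (\<integral>\<^sup>+\<omega>. ennreal \<bar>D n t\<bar> * ennreal \<bar>?Y n \<omega>\<bar> \<partial>M)"
        by (intro nn_integral_cong) (simp add: abs_mult ennreal_mult)
      also have "\<dots> = ennreal \<bar>D n t\<bar> * (\<integral>\<^sup>+\<omega>. ennreal \<bar>?Y n \<omega>\<bar> \<partial>M)"
        using signature_measurable[OF S t0 t(2)] by (intro nn_integral_cmult) simp
      also have "\<dots> \<le> ennreal \<bar>D n t\<bar> * ennreal (2 * ?c n)"
        by (intro mult_left_mono signature_mean_abs_le[OF S t]) simp
      also have "\<dots> = ennreal (2 * (\<bar>D n t\<bar> * ?c n))"
        by (subst ennreal_mult[symmetric]) (auto simp: mult_ac)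
      also have "\<dots> = 2 * ennreal (\<bar>D n t\<bar> * ?c n)"
        by (subst ennreal_mult) auto
      finally show ?thesis by simp
    qed
    then have "(\<Sum>n. \<integral>\<^sup>+\<omega>. ennreal \<bar>?a n * ?Y n \<omega>\<bar> \<partial>M)
        \<le> (\<Sum>n. 2 * ennreal (\<bar>D n t\<bar> * t powr (real n + 1/2) / (fact n * sqrt (2 * real n + 1))))"
      by (intro suminf_le) auto
    also have "\<dots> = 2 * (\<Sum>n. ennreal (\<bar>D n t\<bar> * t powr (real n + 1/2) / (fact n * sqrt (2 * real n + 1))))"
      by (rule ennreal_suminf_cmult)
    also have "\<dots> < \<infinity>"
      using fin1 by (intro ennreal_mult_less_top[THEN iffD2, folded infinity_ennreal_def]) auto
    finally show ?thesis .
  qed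
  show "(\<lambda>N. mean_square M (\<lambda>\<omega>. X t \<omega> - (\<Sum>n<N. ?a n * ?Y n \<omega>))) \<longlonglongrightarrow> 0"
  proof (rule tendsto_sandwich[OF always_eventually always_eventually tendsto_const])
    let ?E = "\<lambda>N. \<integral>\<^sup>+s\<in>{0..t}. ennreal ((k s - (\<Sum>n<N. ?a n * (s ^ n / fact n)))\<^sup>2) \<partial>lborel"
    have "mean_square M (\<lambda>\<omega>. X t \<omega> - (\<Sum>n<N. ?a n * ?Y n \<omega>)) \<le> 4 * ?E N" for N
    proof -
      have "wiener_integral t (\<lambda>s. k s + (-1) * (\<Sum>n<N. ?a n * (s ^ n / fact n)))
          (\<lambda>\<omega>. X t \<omega> + (-1) * (\<Sum>n<N. ?a n * ?Y n \<omega>))"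
        by (intro wiener_integral_add[OF WX] wiener_integral_scale wiener_integral_sum WY t)
      from wiener_integral_mean_square_le[OF this t(2)] show ?thesis by simp
    qed
    then show "\<forall>N. mean_square M (\<lambda>\<omega>. X t \<omega> - (\<Sum>n<N. ?a n * ?Y n \<omega>)) \<le> 4 * ?E N" by blast
    have "?E \<longlonglongrightarrow> 0"
    proof (rule taylor_square_error_tendsto_0[OF _ _ fin2])
      show "k \<in> borel_measurable lborel" using WX by (simp add: wiener_integral_def)
      show "(\<lambda>n. ?a n * (s ^ n / fact n)) sums k s" if "0 \<le> s" "s < t" for s
        using taylor[OF that] that t by (simp add: k_def)
    qed
    then have "(\<lambda>N. 4 * ?E N) \<longlonglongrightarrow> 4 * 0"
      by (intro ennreal_tendsto_cmult) auto
    then show "(\<lambda>N. 4 * ?E N) \<longlonglongrightarrow> 0" by simp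
  qed simp
qed

end

theorem theorem4p5:
  fixes M :: "'a measure" and F :: "real \<Rightarrow> 'a measure" and T :: real
    and W X :: "real \<Rightarrow> 'a \<Rightarrow> real" and S :: "word \<Rightarrow> real \<Rightarrow> 'a \<Rightarrow> real"
    and K :: "real \<Rightarrow> real" and DK :: "nat \<Rightarrow> real \<Rightarrow> real"
  assumes "T > 0"
    and "usual_filtered_prob_space M F T"
    and "brownian_motion M F T W"
    and "is_signature M F T W S"
    and "set_integrable lborel {0<..T} (\<lambda>t. (K t)\<^sup>2)"
    and "has_derivatives_on K DK {0<..T}"
    and "\<And>t. t \<in> {0<..T} \<Longrightarrow>
      (\<Sum>n. ennreal (\<bar>DK n t\<bar> * t powr (real n + 1/2) / (fact n * sqrt (2 * real n + 1)))) < \<infinity>"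
    and "\<And>t. t \<in> {0<..T} \<Longrightarrow>
      (\<integral>\<^sup>+s\<in>{0..t}. (\<Sum>n. ennreal (\<bar>DK n t\<bar> * s ^ n / fact n))\<^sup>2 \<partial>lborel) < \<infinity>"
    and "(\<integral>\<^sup>+t\<in>{0<..T}.
      (\<Sum>n. ennreal (\<bar>DK n t\<bar> * t powr (real n + 1/2) / (fact n * sqrt (2 * real n + 1)))) \<partial>lborel) < \<infinity>"
    and "volterra_process M F T W K X"
  shows "\<forall>t\<in>{0..T}. AE \<omega> in M.
    bracket_defined (volterra_series DK t) (\<lambda>v. S v t \<omega>) \<and>
    X t \<omega> = bracket (volterra_series DK t) (\<lambda>v. S v t \<omega>)"
proof
  fix t assume "t \<in> {0..T}"
  then have t: "0 \<le> t" "t \<le> T" by auto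
  interpret brownian_space M F T W
    by (rule brownian_space.intro[OF assms(2)]) (rule brownian_space_axioms.intro[OF assms(3)])
  show "AE \<omega> in M. bracket_defined (volterra_series DK t) (\<lambda>v. S v t \<omega>) \<and>
    X t \<omega> = bracket (volterra_series DK t) (\<lambda>v. S v t \<omega>)"
  proof (cases "t = 0")
    case True
    \<comment> \<open>At time \<open>0\<close> the series is empty and \<open>X\<close> is an integral over a null set.\<close>
    have W0: "wiener_integral t (\<lambda>s. indicator {0..t} s * K (t - s)) (X t)"
      by (rule volterra_wiener_integral[OF assms(10) t])
    then have Xm [measurable]: "X t \<in> borel_measurable M" by (simp add: wiener_integral_def)
    have "mean_square M (X t) = 0"
      using wiener_integral_mean_square_le[OF W0 t(2)] nn_integral_point[where a = 0] True by simp
    then have "AE \<omega> in M. X t \<omega> = 0"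
      unfolding mean_square_def by (subst (asm) nn_integral_0_iff_AE) auto
    then show ?thesis
      by eventually_elim
         (simp add: True volterra_series_def bracket_def bracket_defined_def bracket_term_def)
  next
    case False
    with t have tp: "0 < t" and tin: "t \<in> {0<..T}" by auto
    have "AE \<omega> in M. summable (\<lambda>n. \<bar>DK n t * (-1) ^ n * S (replicate n Letter1 @ [Letter2]) t \<omega>\<bar>) \<and>
        X t \<omega> = (\<Sum>n. DK n t * (-1) ^ n * S (replicate n Letter1 @ [Letter2]) t \<omega>)"
      by (rule volterra_eq_signature_series[where D = DK, OF assms(4,10) tp t(2)
            taylor_series_sums_kernel[OF assms(6,9) _ _ t(2)] assms(7)[OF tin] assms(8)[OF tin]])
    then show ?thesis
      by eventually_elim
         (use bracket_volterra_series[where D = DK, OF False] in \<open>simp del: abs_mult\<close>)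
  qed
qed

end
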